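(* Let $\frac12<p<1$ and let $f:\mathbb{Z}^+\to[0,\infty)$ be monotonically increasing (non-decreasing). The non-uniform frog model with drift on $\mathbb{Z}$ with parameters $p$ and $f$ is transient if and only if $$\sum_{j=1}^{\infty}e^{-\frac{1-p}{2p-1}f(j)}=\infty.$$
   Context: The non-uniform frog model with drift on $\mathbb{Z}$: for each positive integer $j$, the number $\eta_j$ of sleeping frogs initially at site $j$ is Poisson with mean $f(j)$, the $\eta_j$ being independent. There are no sleeping frogs at non-positive sites. There is one active frog at the origin at time $0$. Each active frog performs a discrete-time random walk on $\mathbb{Z}$ which at each step moves one unit to the left with probability $p$ and one unit to the right with probability $1-p$, independently of all other frogs. Whenever an active frog lands on a site containing sleeping frogs, those frogs become active and start their own such walks from that site. The model is called transient if the probability that infinitely many distinct frogs hit the origin is $0$, and non-transient if this probability is positive. *)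

theory Defs
  imports "HOL-Probability.Probability"
begin

definition pois :: "real \<Rightarrow> nat pmf" where
  "pois r = (if 0 < r then poisson_pmf r else return_pmf 0)"

text \<open>Sample space: eta j = number of sleeping frogs at site j (only j \<ge> 1 used; site 0
  has mean 0), and for each frog label (j,k) an infinite sequence of coin flips,
  True = step to the left. Frog (0,0) is the initially active frog at the origin;
  frog (j,k) with j \<ge> 1 and k < eta j is the k-th sleeping frog at site j.\<close>
type_synonym frog_omega = "(nat \<Rightarrow> nat) \<times> (nat \<times> nat \<Rightarrow> nat \<Rightarrow> bool)"

definition frog_space :: "real \<Rightarrow> (nat \<Rightarrow> real) \<Rightarrow> frog_omega measure" where
  "frog_space p f =
     (PiM UNIV (\<lambda>j::nat. measure_pmf (pois (if j = 0 then 0 else f j))))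
     \<Otimes>\<^sub>M (PiM UNIV (\<lambda>_::nat \<times> nat. PiM UNIV (\<lambda>_::nat. measure_pmf (bernoulli_pmf p))))"

definition frog_pos :: "frog_omega \<Rightarrow> nat \<times> nat \<Rightarrow> nat \<Rightarrow> int" where
  "frog_pos \<omega> a n = int (fst a) + (\<Sum>i<n. if snd \<omega> a i then -1 else 1)"

inductive_set active_frogs :: "frog_omega \<Rightarrow> (nat \<times> nat) set" for \<omega> where
  init: "(0, 0) \<in> active_frogs \<omega>"
| wake: "a \<in> active_frogs \<omega> \<Longrightarrow> 1 \<le> j \<Longrightarrow> k < fst \<omega> j \<Longrightarrow> frog_pos \<omega> a n = int j
          \<Longrightarrow> (j, k) \<in> active_frogs \<omega>"

definition frogs_hitting_origin :: "frog_omega \<Rightarrow> (nat \<times> nat) set" where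
  "frogs_hitting_origin \<omega> = {a \<in> active_frogs \<omega>. \<exists>n. frog_pos \<omega> a n = 0}"

definition frog_transient :: "real \<Rightarrow> (nat \<Rightarrow> real) \<Rightarrow> bool" where
  "frog_transient p f \<longleftrightarrow> (AE \<omega> in frog_space p f. finite (frogs_hitting_origin \<omega>))"

end

theory Submission
  imports Defs
begin

text \<open>
  Write \<open>\<rho> = (1 - p) / p\<close>, so that a frog ever gets \<open>m\<close> steps to the right of its starting point with
  probability \<open>\<rho> ^ m\<close>, and \<open>c = \<rho> / (1 - \<rho>) = (1 - p) / (2 * p - 1)\<close>. By Poisson thinning, the
  probability that no frog starting in \<open>{1..n}\<close> would ever get beyond \<open>n\<close> is \<open>u n = exp (- S n)\<close> with
  \<open>S n = (\<Sum>j=1..n. f j * \<rho> ^ (n + 1 - j))\<close>, and monotonicity of \<open>f\<close> gives \<open>S n \<le> c * f n\<close>.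

  If \<open>exp (- c * f j)\<close> is summable, then so is \<open>u\<close>, because
  \<open>S (n + 1) = \<rho> * S n + (1 - \<rho>) * c * f (n + 1)\<close> and \<open>exp\<close> is convex. By a union bound, with positive
  probability every barrier \<open>n \<ge> N\<close> would be crossed by some frog starting in \<open>{1..n}\<close>; independently,
  the initial frog reaches \<open>N\<close> with positive probability. On both events all frogs wake up, and
  almost surely each of them drifts to the origin.

  Otherwise, call \<open>n\<close> a renewal time if no frog starting in \<open>{1..n}\<close> would get beyond \<open>n\<close>. The expected
  number of renewal times is infinite, and a last-renewal decomposition together with the stochastic
  monotonicity in the starting point coming from that of \<open>f\<close> shows that there are infinitely many of
  them almost surely. A renewal time that exceeds the range of the initial frog confines the process.
\<close>

subsection \<open>Hitting probabilities of the biased walk\<close>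

abbreviation coin_seq :: "real \<Rightarrow> (nat \<Rightarrow> bool) measure" where
  "coin_seq p \<equiv> PiM UNIV (\<lambda>_::nat. measure_pmf (bernoulli_pmf p))"

text \<open>The parameter \<open>b\<close> is the direction counted as \<open>+1\<close>, so one
  analysis covers the displacement to the left (\<open>b = True\<close>, along the drift) and to the
  right (\<open>b = False\<close>, against it).\<close>

definition walk :: "bool \<Rightarrow> (nat \<Rightarrow> bool) \<Rightarrow> nat \<Rightarrow> int" where
  "walk b x n = (\<Sum>i<n. if x i = b then 1 else -1)"

definition hits :: "bool \<Rightarrow> nat \<Rightarrow> (nat \<Rightarrow> bool) \<Rightarrow> bool" where
  "hits b m x \<longleftrightarrow> (\<exists>n. walk b x n = int m)"

definition coin_prob :: "real \<Rightarrow> bool \<Rightarrow> real" where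
  "coin_prob p b = (if b then p else 1 - p)"

lemma walk_0 [simp]: "walk b x 0 = 0"
  by (simp add: walk_def)

lemma walk_Suc: "walk b x (Suc n) = walk b x n + (if x n = b then 1 else -1)"
  by (simp add: walk_def)

lemma walk_case_nat_Suc:
  "walk b (case_nat s x) (Suc n) = (if s = b then 1 else -1) + walk b x n"
  unfolding walk_def by (subst sum.lessThan_Suc_shift) simp

lemma hits_0 [simp]: "hits b 0 x"
  unfolding hits_def by (intro exI[of _ 0]) simp

lemma walk_measurable [measurable]: "(\<lambda>x. walk b x n) \<in> coin_seq p \<rightarrow>\<^sub>M count_space UNIV"
proof (induction n)
  case (Suc n)
  have "(\<lambda>x. if x n = b then walk b x n + 1 else walk b x n - 1) \<in> coin_seq p \<rightarrow>\<^sub>M count_space UNIV"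
    using measurable_compose[OF Suc, of "\<lambda>i. i + 1" "count_space UNIV"]
      measurable_compose[OF Suc, of "\<lambda>i. i - 1" "count_space UNIV"]
    by (intro measurable_If) auto
  then show ?case by (simp add: walk_Suc if_distrib cong: if_cong)
qed simp

lemma hits_measurable [measurable]: "Measurable.pred (coin_seq p) (hits b m)"
  unfolding hits_def by measurable

text \<open>Discrete intermediate value property: steps have size one. If \<open>k < m\<close>, the
  position before the last step is \<open>m - 1\<close> or \<open>m + 1\<close>, still at least
  \<open>k\<close>, so induction on time applies.\<close>

lemma walk_hits_below:
  assumes "walk b x n = int m" "k \<le> m"
  shows "\<exists>i\<le>n. walk b x i = int k"
  using assms
proof (induction n arbitrary: m)
  case 0
  then show ?case by auto
next
  case (Suc n)
  show ?case
  proof (cases "k = m")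
    case True
    then show ?thesis using Suc.prems by auto
  next
    case False
    have "\<exists>m'. walk b x n = int m' \<and> k \<le> m'"
      using Suc.prems False
      by (intro exI[of _ "if x n = b then m - 1 else m + 1"]) (auto simp: walk_Suc split: if_splits)
    then show ?thesis using Suc.IH le_Suc_eq by meson
  qed
qed

lemma hits_antimono: "hits b m x \<Longrightarrow> k \<le> m \<Longrightarrow> hits b k x"
  unfolding hits_def using walk_hits_below by blast

lemma prob_space_coin_seq: "prob_space (coin_seq p)"
  by (intro prob_space_PiM prob_space_measure_pmf)

text \<open>Condition on the first coin: putting an independent coin in front of a coin sequence
  reproduces the law of the sequence. Three separate predicates make this usable for hitting at any
  time and for hitting within a time limit.\<close>

lemma coin_seq_first_step:
  assumes [measurable]: "Measurable.pred (coin_seq p) P" "Measurable.pred (coin_seq p) Q"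
    "Measurable.pred (coin_seq p) R"
  assumes p: "0 \<le> p" "p \<le> 1"
  assumes P: "\<And>s x. P (case_nat s x) \<longleftrightarrow> (if s = b then Q x else R x)"
  shows "measure (coin_seq p) {x. P x} =
    coin_prob p b * measure (coin_seq p) {x. Q x} + (1 - coin_prob p b) * measure (coin_seq p) {x. R x}"
proof -
  interpret S: prob_space "coin_seq p" by (rule prob_space_coin_seq)
  interpret C: sequence_space "measure_pmf (bernoulli_pmf p)"
    by unfold_locales
  have sp: "space (coin_seq p) = UNIV" by (simp add: space_PiM)
  have [measurable]: "{x. P x} \<in> sets (coin_seq p)"
    using predE[OF assms(1)] by (simp add: sp)
  have "Measurable.pred (measure_pmf (bernoulli_pmf p) \<Otimes>\<^sub>M coin_seq p) (\<lambda>z. P (case_nat (fst z) (snd z)))"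
    by measurable
  then have [measurable]: "{z. P (case_nat (fst z) (snd z))} \<in> sets (measure_pmf (bernoulli_pmf p) \<Otimes>\<^sub>M coin_seq p)"
    by (auto simp: pred_def space_pair_measure sp)
  have "emeasure (coin_seq p) {x\<in>space (coin_seq p). P x} =
     emeasure (distr (measure_pmf (bernoulli_pmf p) \<Otimes>\<^sub>M coin_seq p) (coin_seq p) (\<lambda>(s, \<omega>). case_nat s \<omega>)) {x\<in>space (coin_seq p). P x}"
    using C.PiM_iter by simp
  also have "\<dots> = emeasure (measure_pmf (bernoulli_pmf p) \<Otimes>\<^sub>M coin_seq p)
       {z\<in>space (measure_pmf (bernoulli_pmf p) \<Otimes>\<^sub>M coin_seq p). P (case_nat (fst z) (snd z))}"
    by (subst emeasure_distr) (auto intro!: arg_cong2[where f=emeasure] simp: space_pair_measure sp)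
  also have "\<dots> = (\<integral>\<^sup>+s. emeasure (coin_seq p) {x\<in>space (coin_seq p). P (case_nat s x)} \<partial>measure_pmf (bernoulli_pmf p))"
    by (subst S.emeasure_pair_measure_alt)
       (auto intro!: nn_integral_cong arg_cong2[where f=emeasure] simp: space_pair_measure sp)
  also have "\<dots> = (\<integral>\<^sup>+s. ennreal (measure (coin_seq p) {x. if s = b then Q x else R x}) \<partial>measure_pmf (bernoulli_pmf p))"
    by (simp add: P sp S.emeasure_eq_measure)
  also have "\<dots> = ennreal (coin_prob p b * measure (coin_seq p) {x. Q x} + (1 - coin_prob p b) * measure (coin_seq p) {x. R x})"
    using p by (cases b) (simp_all add: coin_prob_def ennreal_plus ennreal_mult mult.commute add.commute)
  finally show ?thesis
    using p unfolding S.emeasure_eq_measure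
    by (subst (asm) ennreal_inj) (auto simp: sp coin_prob_def)
qed

text \<open>The target level is positive, so time \<open>0\<close> cannot be the hitting time. The
  first step then leaves distance \<open>m\<close> or \<open>m + 2\<close>.\<close>

lemma hits_case_nat:
  "hits b (Suc m) (case_nat s x) \<longleftrightarrow> (if s = b then hits b m x else hits b (Suc (Suc m)) x)"
proof -
  have "hits b (Suc m) (case_nat s x) \<longleftrightarrow> (\<exists>n. walk b (case_nat s x) (Suc n) = int (Suc m))"
    unfolding hits_def by (metis not0_implies_Suc of_nat_0 walk_0 of_nat_eq_iff nat.distinct(1))
  also have "\<dots> \<longleftrightarrow> (if s = b then hits b m x else hits b (Suc (Suc m)) x)"
    unfolding hits_def walk_case_nat_Suc by (auto simp: algebra_simps)
  finally show ?thesis .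
qed

lemma hits_before_case_nat:
  "(\<exists>k\<le>Suc n. walk b (case_nat s x) k = int (Suc m)) \<longleftrightarrow>
     (if s = b then \<exists>k\<le>n. walk b x k = int m else \<exists>k\<le>n. walk b x k = int (Suc (Suc m)))"
proof -
  have "(\<exists>k\<le>Suc n. walk b (case_nat s x) k = int (Suc m)) \<longleftrightarrow>
      (\<exists>k\<le>n. walk b (case_nat s x) (Suc k) = int (Suc m))"
    by (metis Suc_le_mono not0_implies_Suc of_nat_0 walk_0 of_nat_eq_iff nat.distinct(1))
  then show ?thesis
    unfolding walk_case_nat_Suc by (auto simp: algebra_simps)
qed

text \<open>Gambler's ruin: rearranged, the recurrence says that each increment is
  \<open>r / (1 - r)\<close> times the previous one.\<close>

lemma two_step_recurrence_differences:
  fixes \<alpha> :: "nat \<Rightarrow> real"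
  assumes rec: "\<And>m. \<alpha> (Suc m) = r * \<alpha> m + (1 - r) * \<alpha> (Suc (Suc m))"
    and r: "0 < r" "r < 1"
  shows "\<alpha> (Suc m) - \<alpha> m = (r / (1 - r)) ^ m * (\<alpha> 1 - \<alpha> 0)"
proof (induction m)
  case (Suc m)
  have "(1 - r) * (\<alpha> (Suc (Suc m)) - \<alpha> (Suc m)) = r * (\<alpha> (Suc m) - \<alpha> m)"
    using rec[of m] by (simp add: algebra_simps)
  then have "\<alpha> (Suc (Suc m)) - \<alpha> (Suc m) = r / (1 - r) * (\<alpha> (Suc m) - \<alpha> m)"
    using r by (simp add: field_simps)
  then show ?case using Suc by simp
qed simp

lemma prob_hits_recurrence:
  assumes "0 \<le> p" "p \<le> 1"
  shows "measure (coin_seq p) {x. hits b (Suc m) x} =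
    coin_prob p b * measure (coin_seq p) {x. hits b m x}
      + (1 - coin_prob p b) * measure (coin_seq p) {x. hits b (Suc (Suc m)) x}"
  by (rule coin_seq_first_step) (use assms in \<open>auto simp: hits_case_nat\<close>)

lemma prob_hits_0: "measure (coin_seq p) {x. hits b 0 x} = 1"
  using prob_space.prob_space[OF prob_space_coin_seq] by (simp add: space_PiM)

text \<open>The increments are geometric with ratio greater than \<open>1\<close>, yet differences
  of probabilities stay bounded. Hence the first increment vanishes and the hitting probability is
  constantly its value at level \<open>0\<close>.\<close>

lemma prob_hits_favourable:
  assumes p: "1/2 < coin_prob p b" "0 < p" "p < 1"
  shows "measure (coin_seq p) {x. hits b m x} = 1"
proof -
  interpret S: prob_space "coin_seq p" by (rule prob_space_coin_seq)
  define r where "r = coin_prob p b"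
  define \<alpha> where "\<alpha> m = measure (coin_seq p) {x. hits b m x}" for m
  have r: "1/2 < r" "r < 1" using p by (auto simp: r_def coin_prob_def split: if_splits)
  define l where "l = r / (1 - r)"
  have l: "1 < l" using r by (simp add: l_def)
  have diff: "\<alpha> (Suc m) - \<alpha> m = l ^ m * (\<alpha> 1 - \<alpha> 0)" for m
    unfolding l_def
  proof (rule two_step_recurrence_differences)
    show "\<alpha> (Suc k) = r * \<alpha> k + (1 - r) * \<alpha> (Suc (Suc k))" for k
      unfolding \<alpha>_def r_def using p by (intro prob_hits_recurrence) auto
  qed (use r in auto)
  have bnd: "0 \<le> \<alpha> m" "\<alpha> m \<le> 1" for m by (auto simp: \<alpha>_def)
  have "\<alpha> 1 - \<alpha> 0 = 0"
  proof (rule ccontr)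
    assume "\<alpha> 1 - \<alpha> 0 \<noteq> 0"
    then obtain m where m: "1 / \<bar>\<alpha> 1 - \<alpha> 0\<bar> < l ^ m"
      using real_arch_pow[OF l] by blast
    then have "1 < l ^ m * \<bar>\<alpha> 1 - \<alpha> 0\<bar>"
      using \<open>\<alpha> 1 - \<alpha> 0 \<noteq> 0\<close> by (simp add: field_simps)
    also have "\<dots> = \<bar>\<alpha> (Suc m) - \<alpha> m\<bar>" unfolding diff[of m] using l by (simp add: abs_mult)
    also have "\<dots> \<le> 1" using bnd[of m] bnd[of "Suc m"] by linarith
    finally show False by simp
  qed
  then have "\<alpha> (Suc m) = \<alpha> m" for m using diff[of m] by simp
  then have "\<alpha> m = \<alpha> 0" by (induction m) auto
  then show ?thesis using prob_hits_0[of p b] unfolding \<alpha>_def by simp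
qed

text \<open>The recurrence for \<open>hits\<close> alone is also solved by the constant
  \<open>1\<close>. Bounding the time-limited probabilities, by induction on the time limit, singles
  out the decaying solution.\<close>

lemma prob_hits_before_le:
  assumes p: "coin_prob p b < 1/2" "0 < p" "p < 1"
  shows "measure (coin_seq p) {x. \<exists>k\<le>n. walk b x k = int m} \<le> (coin_prob p b / (1 - coin_prob p b)) ^ m"
proof (induction n arbitrary: m)
  case 0
  show ?case
  proof (cases m)
    case 0
    then show ?thesis using prob_space.prob_le_1[OF prob_space_coin_seq] by simp
  next
    case (Suc k)
    then show ?thesis using p by (simp add: coin_prob_def)
  qed
next
  case (Suc n)
  define r where "r = coin_prob p b"
  have r: "0 < r" "r < 1/2" using p by (auto simp: r_def coin_prob_def split: if_splits)
  show ?case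
  proof (cases m)
    case 0
    then show ?thesis using prob_space.prob_le_1[OF prob_space_coin_seq] by simp
  next
    case (Suc k)
    have "measure (coin_seq p) {x. \<exists>k\<le>Suc n. walk b x k = int m} =
      r * measure (coin_seq p) {x. \<exists>j\<le>n. walk b x j = int k}
      + (1 - r) * measure (coin_seq p) {x. \<exists>j\<le>n. walk b x j = int (Suc (Suc k))}"
      unfolding Suc r_def by (rule coin_seq_first_step, unfold hits_before_case_nat) (use p in simp_all)
    also have "\<dots> \<le> r * (r / (1 - r)) ^ k + (1 - r) * (r / (1 - r)) ^ Suc (Suc k)"
      using r Suc.IH[of k] Suc.IH[of "Suc (Suc k)"] unfolding r_def[symmetric]
      by (intro add_mono mult_left_mono) auto
    \<comment> \<open>With \<open>t = r / (1 - r)\<close> this is the fixed-point identity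
      \<open>r + (1 - r) * t^2 = t\<close>, multiplied by \<open>t ^ k\<close>.\<close>
    also have "\<dots> = (r / (1 - r)) ^ Suc k"
    proof -
      define t where "t = r / (1 - r)"
      have t: "(1 - r) * t = r" using r by (simp add: t_def)
      have "r * t ^ k + (1 - r) * t ^ Suc (Suc k) = (1 - r) * t * t ^ k + (1 - r) * t * t ^ Suc k"
        unfolding t by (simp add: t flip: mult.assoc)
      also have "\<dots> = (1 - r) * t ^ Suc k + r * t ^ Suc k" by (simp only: t) (simp add: t flip: mult.assoc)
      also have "\<dots> = t ^ Suc k" by (simp add: algebra_simps)
      finally show ?thesis by (simp add: t_def)
    qed
    finally show ?thesis by (simp add: Suc r_def)
  qed
qed

text \<open>Summing the geometric increments leaves one unknown, the first increment
  \<open>d\<close>. The time-limited bound passes to the limit and forces the probabilities to tend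
  to \<open>0\<close>, which gives \<open>d = - (1 - l)\<close>.\<close>

lemma prob_hits_unfavourable:
  assumes p: "coin_prob p b < 1/2" "0 < p" "p < 1"
  shows "measure (coin_seq p) {x. hits b m x} = (coin_prob p b / (1 - coin_prob p b)) ^ m"
proof -
  interpret S: prob_space "coin_seq p" by (rule prob_space_coin_seq)
  define r where "r = coin_prob p b"
  define \<alpha> where "\<alpha> m = measure (coin_seq p) {x. hits b m x}" for m
  have r: "0 < r" "r < 1/2" using p by (auto simp: r_def coin_prob_def split: if_splits)
  define l where "l = r / (1 - r)"
  have l: "0 < l" "l < 1" using r by (auto simp: l_def)
  have diff: "\<alpha> (Suc m) - \<alpha> m = l ^ m * (\<alpha> 1 - \<alpha> 0)" for m
    unfolding l_def
  proof (rule two_step_recurrence_differences)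
    show "\<alpha> (Suc k) = r * \<alpha> k + (1 - r) * \<alpha> (Suc (Suc k))" for k
      unfolding \<alpha>_def r_def using p by (intro prob_hits_recurrence) auto
  qed (use r in auto)
  define d where "d = \<alpha> 1 - \<alpha> 0"
  have le: "\<alpha> m \<le> l ^ m" for m
  proof -
    have "(\<lambda>n. measure (coin_seq p) {x. \<exists>k\<le>n. walk b x k = int m})
        \<longlonglongrightarrow> measure (coin_seq p) (\<Union>n. {x. \<exists>k\<le>n. walk b x k = int m})"
    proof (rule S.finite_Lim_measure_incseq)
      have "{x \<in> space (coin_seq p). \<exists>k\<le>n. walk b x k = int m} \<in> sets (coin_seq p)" for n
        by measurable
      then show "range (\<lambda>n. {x. \<exists>k\<le>n. walk b x k = int m}) \<subseteq> sets (coin_seq p)"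
        by (auto simp: space_PiM)
    qed (auto simp: incseq_def intro: order_trans)
    moreover have "(\<Union>n. {x. \<exists>k\<le>n. walk b x k = int m}) = {x. hits b m x}"
      by (auto simp: hits_def)
    ultimately show ?thesis
      unfolding \<alpha>_def l_def r_def
      by (intro LIMSEQ_le_const2) (auto intro: prob_hits_before_le[OF p])
  qed
  have \<alpha>: "\<alpha> m = 1 + d * ((1 - l ^ m) / (1 - l))" for m
  proof (induction m)
    case 0
    have "\<alpha> 0 = 1" unfolding \<alpha>_def by (rule prob_hits_0)
    then show ?case by simp
  next
    case (Suc m)
    have "1 - l ^ Suc m = (1 - l ^ m) + l ^ m * (1 - l)" by (simp add: algebra_simps)
    then have "(1 - l ^ Suc m) / (1 - l) = (1 - l ^ m) / (1 - l) + l ^ m"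
      using l by (simp only: add_divide_distrib) simp
    then show ?case using diff[of m] Suc unfolding d_def[symmetric] by (simp only: distrib_left) (simp add: mult.commute)
  qed
  have pow: "(\<lambda>m. l ^ m) \<longlonglongrightarrow> 0" using l by (intro LIMSEQ_realpow_zero) auto
  have "\<alpha> \<longlonglongrightarrow> 0"
    by (rule tendsto_sandwich[OF _ _ tendsto_const pow]) (use le in \<open>auto simp: \<alpha>_def\<close>)
  moreover have "(\<lambda>m. 1 + d * ((1 - l ^ m) / (1 - l))) \<longlonglongrightarrow> 1 + d * ((1 - 0) / (1 - l))"
    using l by (intro tendsto_intros pow) auto
  ultimately have "0 = 1 + d * ((1 - 0) / (1 - l))"
    unfolding \<alpha>[symmetric] by (rule LIMSEQ_unique)
  then have "d = - (1 - l)" using l by (simp add: field_simps)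
  then have "d * ((1 - l ^ m) / (1 - l)) = - (1 - l ^ m)" using l by (simp del: minus_diff_eq)
  then have "\<alpha> m = l ^ m" using \<alpha>[of m] by simp
  then show ?thesis by (simp add: \<alpha>_def l_def r_def)
qed

subsection \<open>Poisson thinning on the frog space\<close>

text \<open>This is the Poisson generating function. With \<open>s\<close> the chance that a single
  frog avoids some event, it gives the chance that all frogs of a site avoid it.\<close>

lemma nn_integral_pois_power:
  assumes "0 \<le> t" "0 \<le> s"
  shows "(\<integral>\<^sup>+k. ennreal (s ^ k) \<partial>measure_pmf (pois t)) = ennreal (exp (- t * (1 - s)))"
proof (cases "t = 0")
  case True
  then show ?thesis by (simp add: pois_def)
next
  case False
  with assms have t: "0 < t" by simp
  have "(\<lambda>k. (t * s) ^ k /\<^sub>R fact k) sums exp (t * s)" by (rule exp_converges)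
  then have "(\<lambda>k. exp (- t) * ((t * s) ^ k /\<^sub>R fact k)) sums (exp (- t) * exp (t * s))"
    by (rule sums_mult)
  moreover have "exp (- t) * exp (t * s) = exp (- t * (1 - s))"
    by (simp add: algebra_simps flip: exp_add)
  moreover have "exp (- t) * ((t * s) ^ k /\<^sub>R fact k) = pmf (pois t) k * s ^ k" for k
    using t by (simp add: pois_def power_mult_distrib field_simps)
  ultimately have sums: "(\<lambda>k. pmf (pois t) k * s ^ k) sums exp (- t * (1 - s))" by simp
  have "(\<integral>\<^sup>+k. ennreal (s ^ k) \<partial>measure_pmf (pois t)) = (\<Sum>k. ennreal (pmf (pois t) k * s ^ k))"
    using assms by (simp add: nn_integral_measure_pmf nn_integral_count_space_nat ennreal_mult)
  also have "\<dots> = ennreal (exp (- t * (1 - s)))"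
    using assms sums by (intro suminf_ennreal_eq) auto
  finally show ?thesis .
qed

text \<open>Only finitely many coordinates enter, so the integral can be pushed forward to the
  finite product over \<open>J\<close>, where it factorises.\<close>

lemma nn_integral_PiM_prod_components:
  fixes M :: "'i \<Rightarrow> 'a measure"
  assumes "\<And>i. prob_space (M i)" "finite J"
    and [measurable]: "\<And>i. g i \<in> borel_measurable (M i)"
  shows "(\<integral>\<^sup>+x. (\<Prod>i\<in>J. g i (x i)) \<partial>PiM UNIV M) = (\<Prod>i\<in>J. \<integral>\<^sup>+x. g i x \<partial>M i)"
proof -
  interpret product_prob_space M UNIV using assms(1) by (intro product_prob_spaceI)
  have "(\<integral>\<^sup>+x. (\<Prod>i\<in>J. g i (x i)) \<partial>PiM UNIV M) = (\<integral>\<^sup>+x. (\<Prod>i\<in>J. g i (restrict x J i)) \<partial>PiM UNIV M)"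
    by (intro nn_integral_cong prod.cong) auto
  also have "\<dots> = (\<integral>\<^sup>+x. (\<Prod>i\<in>J. g i (x i)) \<partial>distr (PiM UNIV M) (PiM J M) (\<lambda>x. restrict x J))"
    by (subst nn_integral_distr) (auto intro: measurable_restrict_subset)
  also have "\<dots> = (\<Prod>i\<in>J. \<integral>\<^sup>+x. g i x \<partial>M i)"
    using assms(2) by (simp add: distr_PiM_restrict_finite product_nn_integral_prod)
  finally show ?thesis .
qed

section \<open>Measurability and cylinder probabilities on the frog space\<close>

lemma space_frog_space [simp]: "space (frog_space p f) = UNIV"
  by (simp add: frog_space_def space_pair_measure space_PiM)

lemma prob_space_frog_space: "prob_space (frog_space p f)"
  unfolding frog_space_def
  by (intro prob_space_pair prob_space_PiM prob_space_measure_pmf)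

lemma frog_count_measurable [measurable]:
  "(\<lambda>\<omega>. fst \<omega> j) \<in> frog_space p f \<rightarrow>\<^sub>M count_space UNIV"
proof -
  have "(\<lambda>\<omega>. fst \<omega> j) \<in> frog_space p f \<rightarrow>\<^sub>M measure_pmf (pois (if j = 0 then 0 else f j))"
    unfolding frog_space_def
    by (intro measurable_compose[OF measurable_fst] measurable_component_singleton) simp
  then show ?thesis by simp
qed

lemma frog_coins_measurable [measurable]:
  "(\<lambda>\<omega>. snd \<omega> a) \<in> frog_space p f \<rightarrow>\<^sub>M coin_seq p"
  unfolding frog_space_def
  by (intro measurable_compose[OF measurable_snd] measurable_component_singleton) simp

text \<open>Fix the counts first: the coin sequences of different labels are independent, so site
  \<open>j\<close> contributes a power with exponent \<open>\<eta> j\<close>. Integrating over the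
  counts turns each power into an exponential.\<close>

lemma prob_frog_space_cylinder:
  fixes I :: "nat set" and H :: "nat \<Rightarrow> (nat \<Rightarrow> bool) \<Rightarrow> bool"
  assumes [measurable]: "Measurable.pred (coin_seq p) C" "\<And>j. Measurable.pred (coin_seq p) (H j)"
    and I: "finite I" "0 \<notin> I" and f: "\<And>j. j \<in> I \<Longrightarrow> 0 \<le> f j"
  shows "measure (frog_space p f) {\<omega>. C (snd \<omega> (0, 0)) \<and> (\<forall>j\<in>I. \<forall>k<fst \<omega> j. \<not> H j (snd \<omega> (j, k)))}
    = measure (coin_seq p) {x. C x} * (\<Prod>j\<in>I. exp (- f j * measure (coin_seq p) {x. H j x}))"
proof -
  define A where "A = PiM UNIV (\<lambda>j::nat. measure_pmf (pois (if j = 0 then 0 else f j)))"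
  define B where "B = PiM UNIV (\<lambda>_::nat \<times> nat. coin_seq p)"
  have AB: "frog_space p f = A \<Otimes>\<^sub>M B" by (simp add: frog_space_def A_def B_def)
  interpret F: prob_space "frog_space p f" by (rule prob_space_frog_space)
  interpret S: prob_space "coin_seq p" by (rule prob_space_coin_seq)
  interpret B: prob_space B unfolding B_def by (intro prob_space_PiM prob_space_coin_seq)
  interpret P: product_prob_space "\<lambda>_::nat \<times> nat. coin_seq p" UNIV
    by (intro product_prob_spaceI prob_space_coin_seq)
  have sp: "space (coin_seq p) = UNIV" by (simp add: space_PiM)
  have [measurable]: "{x. C x} \<in> sets (coin_seq p)" "{x. H j x} \<in> sets (coin_seq p)" for j
    using predE[OF assms(1)] predE[OF assms(2)] by (simp_all add: sp)
  have neg: "{x. \<not> H j x} \<in> sets (coin_seq p)" for j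
    using sets.compl_sets[of "{x. H j x}" "coin_seq p"] by (simp add: sp Collect_neg_eq Compl_eq_Diff_UNIV)
  define X where "X = {\<omega> :: frog_omega. C (snd \<omega> (0, 0)) \<and> (\<forall>j\<in>I. \<forall>k<fst \<omega> j. \<not> H j (snd \<omega> (j, k)))}"
  have "{\<omega> \<in> space (frog_space p f). C (snd \<omega> (0, 0)) \<and> (\<forall>j\<in>I. \<forall>k. k < fst \<omega> j \<longrightarrow> \<not> H j (snd \<omega> (j, k)))}
      \<in> sets (frog_space p f)"
    using I by measurable
  then have X: "X \<in> sets (A \<Otimes>\<^sub>M B)" unfolding X_def AB[symmetric] by simp
  define h where "h j = measure (coin_seq p) {x. H j x}" for j
  define c where "c = measure (coin_seq p) {x. C x}"
  have h: "0 \<le> 1 - h j" for j by (simp add: h_def)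
  have comp: "emeasure (coin_seq p) {x. \<not> H j x} = ennreal (1 - h j)" for j
    using S.prob_compl[of "{x. H j x}"] by (simp add: h_def S.emeasure_eq_measure sp Compl_eq set_diff_eq)
  have sec: "emeasure B (Pair \<eta> -` X) = ennreal c * (\<Prod>j\<in>I. ennreal ((1 - h j) ^ \<eta> j))" for \<eta>
  proof -
    define J where "J = (SIGMA j:I. {..<\<eta> j})"
    \<comment> \<open>\<open>T\<close> lists the constraint on each relevant label. Since
      \<open>0\<close> is not in \<open>I\<close>, the label of the initial frog does not clash with
      those in \<open>J\<close>.\<close>
    define T where "T a = (if a = (0, 0) then {x. C x} else {x. \<not> H (fst a) x})" for a :: "nat \<times> nat"
    have J: "finite J" "(0, 0) \<notin> J" using I by (auto simp: J_def)
    have "Pair \<eta> -` X = {w\<in>space B. \<forall>a\<in>insert (0, 0) J. w a \<in> T a}"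
      using I by (auto simp: X_def J_def T_def B_def space_PiM)
    also have "emeasure B \<dots> = (\<Prod>a\<in>insert (0, 0) J. emeasure (coin_seq p) (T a))"
      unfolding B_def using J by (intro P.emeasure_PiM_Collect) (auto simp: T_def neg)
    also have "\<dots> = ennreal c * (\<Prod>a\<in>J. emeasure (coin_seq p) {x. \<not> H (fst a) x})"
    proof -
      have "(\<Prod>a\<in>J. emeasure (coin_seq p) (T a)) = (\<Prod>a\<in>J. emeasure (coin_seq p) {x. \<not> H (fst a) x})"
        using J by (intro prod.cong) (auto simp: T_def)
      then show ?thesis using J by (simp add: T_def c_def S.emeasure_eq_measure)
    qed
    also have "(\<Prod>a\<in>J. emeasure (coin_seq p) {x. \<not> H (fst a) x}) =
        (\<Prod>j\<in>I. \<Prod>k<\<eta> j. emeasure (coin_seq p) {x. \<not> H j x})"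
      unfolding J_def using I by (subst prod.Sigma) (auto simp: split_def)
    also have "\<dots> = (\<Prod>j\<in>I. ennreal ((1 - h j) ^ \<eta> j))"
      using h by (simp add: comp ennreal_power)
    finally show ?thesis .
  qed
  have "emeasure (frog_space p f) X = (\<integral>\<^sup>+\<eta>. emeasure B (Pair \<eta> -` X) \<partial>A)"
    unfolding AB using X by (rule B.emeasure_pair_measure_alt)
  also have "\<dots> = ennreal c * (\<integral>\<^sup>+\<eta>. (\<Prod>j\<in>I. ennreal ((1 - h j) ^ \<eta> j)) \<partial>A)"
    unfolding sec by (rule nn_integral_cmult) (simp add: A_def)
  also have "(\<integral>\<^sup>+\<eta>. (\<Prod>j\<in>I. ennreal ((1 - h j) ^ \<eta> j)) \<partial>A) =
      (\<Prod>j\<in>I. \<integral>\<^sup>+k. ennreal ((1 - h j) ^ k) \<partial>measure_pmf (pois (if j = 0 then 0 else f j)))"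
    unfolding A_def using I
    by (intro nn_integral_PiM_prod_components[where g = "\<lambda>j k. ennreal ((1 - h j) ^ k)"]) (auto intro: prob_space_measure_pmf)
  also have "\<dots> = (\<Prod>j\<in>I. ennreal (exp (- f j * h j)))"
    using I f h by (intro prod.cong refl) (subst nn_integral_pois_power, auto)
  finally have "emeasure (frog_space p f) X = ennreal (c * (\<Prod>j\<in>I. exp (- f j * h j)))"
    by (simp add: prod_ennreal ennreal_mult c_def prod_nonneg)
  then show ?thesis
    unfolding F.emeasure_eq_measure X_def c_def h_def
    by (subst (asm) ennreal_inj) (auto intro!: mult_nonneg_nonneg prod_nonneg)
qed

subsection \<open>Stochastic monotonicity of product laws\<close>

text \<open>The point masses are the increments of \<open>G\<close>: partial sums telescope back to
  \<open>G\<close>, and its limit gives total mass \<open>1\<close>.\<close>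

lemma exists_pmf_with_cdf:
  fixes G :: "nat \<Rightarrow> real"
  assumes "mono G" "0 \<le> G 0" "G \<longlonglongrightarrow> 1"
  shows "\<exists>\<nu>. \<forall>a. measure_pmf.prob \<nu> {..a} = G a"
proof -
  define w where "w a = G a - (if a = 0 then 0 else G (a - 1))" for a
  have w: "0 \<le> w a" for a using assms(2) monoD[OF assms(1), of "a - 1" a] by (auto simp: w_def)
  have sum: "(\<Sum>i\<le>a. w i) = G a" for a
    by (induction a) (auto simp: w_def)
  have "w sums 1"
    unfolding sums_def by (rule LIMSEQ_imp_Suc) (use assms(3) in \<open>simp add: lessThan_Suc_atMost sum\<close>)
  then have "(\<Sum>x. ennreal (w x)) = ennreal 1" by (rule suminf_ennreal_eq[OF w])
  then have "(\<integral>\<^sup>+x. ennreal (w x) \<partial>count_space UNIV) = 1"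
    by (simp only: nn_integral_count_space_nat ennreal_1)
  then have "pmf (embed_pmf w) = w"
    using w by (intro ext pmf_embed_pmf) auto
  then have "measure_pmf.prob (embed_pmf w) {..a} = G a" for a
    by (simp add: measure_measure_pmf_finite sum)
  then show ?thesis by blast
qed

lemma countable_PiE_dflt_nat: "finite I \<Longrightarrow> countable (PiE_dflt I 0 (\<lambda>_. UNIV :: nat set))"
  unfolding dflt_image_PiE[symmetric] by (intro countable_image countable_PiE) auto

text \<open>Coordinates are moved one at a time from inequality constraints (\<open>K\<close>) to
  equality constraints (\<open>J\<close>), because a positive value \<open>Suc r\<close> is taken
  exactly on the difference of the events for the bounds \<open>Suc r\<close> and \<open>r\<close>.
  The event \<open>Z\<close> is carried along to retain independence from it.\<close>

lemma (in prob_space) prob_eq_from_joint_cdf: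
  fixes X :: "'i \<Rightarrow> 'a \<Rightarrow> nat"
  assumes [measurable]: "Z \<in> events" "\<And>i. X i \<in> M \<rightarrow>\<^sub>M count_space UNIV"
    and cdf: "\<And>a. prob (Z \<inter> {\<omega>\<in>space M. \<forall>i\<in>I. X i \<omega> \<le> a i}) = prob Z * (\<Prod>i\<in>I. measure_pmf.prob (\<nu> i) {..a i})"
    and "finite J" "finite K" "J \<inter> K = {}" "J \<union> K = I"
  shows "prob (Z \<inter> {\<omega>\<in>space M. (\<forall>i\<in>J. X i \<omega> = v i) \<and> (\<forall>i\<in>K. X i \<omega> \<le> a i)}) =
    prob Z * (\<Prod>i\<in>J. pmf (\<nu> i) (v i)) * (\<Prod>i\<in>K. measure_pmf.prob (\<nu> i) {..a i})"
  using assms(4-)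
proof (induction J arbitrary: K a rule: finite_induct)
  case empty
  then show ?case using cdf[of a] by simp
next
  case (insert i J)
  define E where "E b = Z \<inter> {\<omega>\<in>space M. (\<forall>i\<in>J. X i \<omega> = v i) \<and> (\<forall>i\<in>insert i K. X i \<omega> \<le> b i)}" for b
  let ?c = "prob Z * (\<Prod>i\<in>J. pmf (\<nu> i) (v i)) * (\<Prod>i\<in>K. measure_pmf.prob (\<nu> i) {..a i})"
  have E: "E b \<in> events" for b
  proof -
    have "finite (insert i K)" "finite J" using insert by auto
    then have "{\<omega>\<in>space M. (\<forall>i\<in>J. X i \<omega> = v i) \<and> (\<forall>i\<in>insert i K. X i \<omega> \<le> b i)} \<in> events"
      by measurable
    then show ?thesis unfolding E_def by (rule sets.Int[OF assms(1)])
  qed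
  have iK: "i \<notin> K" using insert by auto
  have pE: "prob (E (a(i := r))) = ?c * measure_pmf.prob (\<nu> i) {..r}" for r
  proof -
    have "prob (E (a(i := r))) = prob Z * (\<Prod>i\<in>J. pmf (\<nu> i) (v i)) *
        (\<Prod>j\<in>insert i K. measure_pmf.prob (\<nu> j) {..(a(i := r)) j})"
      unfolding E_def using insert by (intro insert.IH) auto
    also have "(\<Prod>j\<in>insert i K. measure_pmf.prob (\<nu> j) {..(a(i := r)) j}) =
        measure_pmf.prob (\<nu> i) {..r} * (\<Prod>j\<in>K. measure_pmf.prob (\<nu> j) {..a j})"
      using insert iK by (subst prod.insert) (auto intro!: prod.cong)
    finally show ?thesis by (simp only: mult_ac)
  qed
  have "prob (Z \<inter> {\<omega>\<in>space M. (\<forall>i\<in>insert i J. X i \<omega> = v i) \<and> (\<forall>i\<in>K. X i \<omega> \<le> a i)}) =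
      ?c * pmf (\<nu> i) (v i)"
  proof (cases "v i")
    case 0
    have "Z \<inter> {\<omega>\<in>space M. (\<forall>i\<in>insert i J. X i \<omega> = v i) \<and> (\<forall>i\<in>K. X i \<omega> \<le> a i)} = E (a(i := 0))"
      using iK 0 by (auto simp: E_def)
    then show ?thesis using pE[of 0] 0 by (simp add: measure_pmf_single)
  next
    case (Suc r)
    have "Z \<inter> {\<omega>\<in>space M. (\<forall>i\<in>insert i J. X i \<omega> = v i) \<and> (\<forall>i\<in>K. X i \<omega> \<le> a i)}
        = E (a(i := Suc r)) - E (a(i := r))"
      using iK Suc by (auto simp: E_def le_Suc_eq)
    moreover have "E (a(i := r)) \<subseteq> E (a(i := Suc r))" using iK by (force simp: E_def)
    ultimately have "prob (Z \<inter> {\<omega>\<in>space M. (\<forall>i\<in>insert i J. X i \<omega> = v i) \<and> (\<forall>i\<in>K. X i \<omega> \<le> a i)})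
        = ?c * (measure_pmf.prob (\<nu> i) {..Suc r} - measure_pmf.prob (\<nu> i) {..r})"
      by (simp add: finite_measure_Diff E pE right_diff_distrib)
    also have "measure_pmf.prob (\<nu> i) {..Suc r} - measure_pmf.prob (\<nu> i) {..r} = pmf (\<nu> i) (v i)"
      by (simp add: Suc measure_measure_pmf_finite)
    finally show ?thesis .
  qed
  then show ?case using insert by simp
qed

text \<open>Setting the coordinates outside \<open>I\<close> to \<open>0\<close>, the default of
  \<open>Pi_pmf\<close>, leaves only countably many possible vectors. The event is therefore a
  countable disjoint union of the point events of the preceding lemma.\<close>

lemma (in prob_space) prob_eq_Pi_pmf:
  fixes X :: "'i \<Rightarrow> 'a \<Rightarrow> nat"
  assumes [measurable]: "Z \<in> events" "\<And>i. X i \<in> M \<rightarrow>\<^sub>M count_space UNIV"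
    and I: "finite I"
    and cdf: "\<And>a. prob (Z \<inter> {\<omega>\<in>space M. \<forall>i\<in>I. X i \<omega> \<le> a i}) = prob Z * (\<Prod>i\<in>I. measure_pmf.prob (\<nu> i) {..a i})"
  shows "prob (Z \<inter> {\<omega>\<in>space M. (\<lambda>i. if i \<in> I then X i \<omega> else 0) \<in> A}) =
    prob Z * measure_pmf.prob (Pi_pmf I 0 \<nu>) A"
proof -
  define D where "D = PiE_dflt I 0 (\<lambda>_. UNIV :: nat set)"
  define E where "E v = Z \<inter> {\<omega>\<in>space M. \<forall>i\<in>I. X i \<omega> = v i}" for v
  have E: "E v \<in> events" for v
  proof -
    have "{\<omega>\<in>space M. \<forall>i\<in>I. X i \<omega> = v i} \<in> events" using I by measurable
    then show ?thesis unfolding E_def by (rule sets.Int[OF assms(1)])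
  qed
  have "E v \<inter> E w = {}" if vw: "v \<in> D" "w \<in> D" "v \<noteq> w" for v w
  proof -
    obtain i where "v i \<noteq> w i" using vw(3) by blast
    moreover from this have "i \<in> I" using vw(1,2) by (cases "i \<in> I") (auto simp: D_def PiE_dflt_def)
    ultimately show ?thesis by (auto simp: E_def)
  qed
  then have disj: "disjoint_family_on E (A \<inter> D)" by (auto simp: disjoint_family_on_def)
  have "Z \<inter> {\<omega>\<in>space M. (\<lambda>i. if i \<in> I then X i \<omega> else 0) \<in> A} = (\<Union>v\<in>A \<inter> D. E v)"
  proof (intro equalityI subsetI)
    fix \<omega> assume "\<omega> \<in> Z \<inter> {\<omega>\<in>space M. (\<lambda>i. if i \<in> I then X i \<omega> else 0) \<in> A}"
    then have "(\<lambda>i. if i \<in> I then X i \<omega> else 0) \<in> A \<inter> D" "\<omega> \<in> E (\<lambda>i. if i \<in> I then X i \<omega> else 0)"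
      by (auto simp: D_def PiE_dflt_def E_def)
    then show "\<omega> \<in> (\<Union>v\<in>A \<inter> D. E v)" by blast
  next
    fix \<omega> assume "\<omega> \<in> (\<Union>v\<in>A \<inter> D. E v)"
    then obtain v where v: "v \<in> A" "v \<in> D" "\<omega> \<in> E v" by blast
    then have "(\<lambda>i. if i \<in> I then X i \<omega> else 0) = v"
      by (auto simp: D_def PiE_dflt_def E_def)
    then show "\<omega> \<in> Z \<inter> {\<omega>\<in>space M. (\<lambda>i. if i \<in> I then X i \<omega> else 0) \<in> A}"
      using v by (simp add: E_def)
  qed
  then have "emeasure M (Z \<inter> {\<omega>\<in>space M. (\<lambda>i. if i \<in> I then X i \<omega> else 0) \<in> A}) =
      (\<integral>\<^sup>+v. emeasure M (E v) \<partial>count_space (A \<inter> D))"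
    using disj countable_PiE_dflt_nat[OF I] by (simp add: emeasure_UN_countable E D_def)
  also have "\<dots> = (\<integral>\<^sup>+v. ennreal (prob Z) * ennreal (pmf (Pi_pmf I 0 \<nu>) v) \<partial>count_space (A \<inter> D))"
  proof (intro nn_integral_cong)
    fix v assume "v \<in> space (count_space (A \<inter> D))"
    then have "v \<in> D" by simp
    have "prob (E v) = prob Z * (\<Prod>i\<in>I. pmf (\<nu> i) (v i))"
      using prob_eq_from_joint_cdf[OF assms(1,2) cdf, of I "{}" v] I by (simp add: E_def)
    also have "(\<Prod>i\<in>I. pmf (\<nu> i) (v i)) = pmf (Pi_pmf I 0 \<nu>) v"
      using \<open>v \<in> D\<close> I by (subst pmf_Pi') (auto simp: D_def PiE_dflt_def)
    finally show "emeasure M (E v) = ennreal (prob Z) * ennreal (pmf (Pi_pmf I 0 \<nu>) v)"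
      by (simp add: emeasure_eq_measure ennreal_mult)
  qed
  also have "\<dots> = ennreal (prob Z) * emeasure (Pi_pmf I 0 \<nu>) (A \<inter> D)"
    by (simp add: nn_integral_cmult nn_integral_pmf)
  also have "emeasure (Pi_pmf I 0 \<nu>) (A \<inter> D) = emeasure (Pi_pmf I 0 \<nu>) A"
  proof (rule emeasure_eq_AE)
    show "AE v in Pi_pmf I 0 \<nu>. v \<in> A \<inter> D \<longleftrightarrow> v \<in> A"
      using set_Pi_pmf_subset[OF I, of 0 \<nu>] by (auto simp: AE_measure_pmf_iff D_def PiE_dflt_def)
  qed auto
  finally show ?thesis
    by (simp add: emeasure_eq_measure measure_pmf.emeasure_eq_measure flip: ennreal_mult)
qed

text \<open>The marginals are replaced one at a time. With the other coordinates fixed, the section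
  of an up-closed set is empty or a ray \<open>{l..}\<close>, so comparing tails suffices;
  exchanging the order of sampling exposes the coordinate \<open>x\<close>.\<close>

lemma emeasure_Pi_pmf_upclosed_mono:
  fixes \<nu> \<nu>' :: "'i \<Rightarrow> nat pmf"
  assumes "finite I"
    and dom: "\<And>i r. i \<in> I \<Longrightarrow> measure_pmf.prob (\<nu> i) {r..} \<le> measure_pmf.prob (\<nu>' i) {r..}"
    and "\<And>v w. v \<in> A \<Longrightarrow> (\<And>i. v i \<le> w i) \<Longrightarrow> w \<in> A"
  shows "emeasure (Pi_pmf I 0 \<nu>) A \<le> emeasure (Pi_pmf I 0 \<nu>') A"
  using assms
proof (induction I arbitrary: A rule: finite_induct)
  case empty
  then show ?case by simp
next
  case (insert x I)
  have up: "w \<in> {g. g(x := y) \<in> A}" if "v \<in> {g. g(x := y) \<in> A}" "\<And>i. v i \<le> w i" for v w y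
  proof -
    have "(v(x := y)) i \<le> (w(x := y)) i" for i using that(2) by simp
    then show ?thesis using insert.prems(2)[of "v(x := y)" "w(x := y)"] that(1) by blast
  qed
  have "emeasure (Pi_pmf (insert x I) 0 \<nu>) A =
      (\<integral>\<^sup>+y. emeasure (Pi_pmf I 0 \<nu>) {g. g(x := y) \<in> A} \<partial>\<nu> x)"
    using insert.hyps by (simp add: Pi_pmf_insert' emeasure_bind_pmf map_pmf_def[symmetric] vimage_def)
  also have "\<dots> \<le> (\<integral>\<^sup>+y. emeasure (Pi_pmf I 0 \<nu>') {g. g(x := y) \<in> A} \<partial>\<nu> x)"
    using insert.prems(1) up by (intro nn_integral_mono insert.IH) auto
  also have "\<dots> = emeasure (bind_pmf (\<nu> x) (\<lambda>y. bind_pmf (Pi_pmf I 0 \<nu>') (\<lambda>g. return_pmf (g(x := y))))) A"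
    by (simp add: emeasure_bind_pmf map_pmf_def[symmetric] vimage_def)
  also have "\<dots> = emeasure (bind_pmf (Pi_pmf I 0 \<nu>') (\<lambda>g. bind_pmf (\<nu> x) (\<lambda>y. return_pmf (g(x := y))))) A"
    by (simp only: bind_commute_pmf[of "\<nu> x" "Pi_pmf I 0 \<nu>'"])
  also have "\<dots> = (\<integral>\<^sup>+g. emeasure (\<nu> x) {y. g(x := y) \<in> A} \<partial>Pi_pmf I 0 \<nu>')"
    by (simp add: emeasure_bind_pmf map_pmf_def[symmetric] vimage_def)
  also have "\<dots> \<le> (\<integral>\<^sup>+g. emeasure (\<nu>' x) {y. g(x := y) \<in> A} \<partial>Pi_pmf I 0 \<nu>')"
  proof (intro nn_integral_mono)
    fix g
    show "emeasure (\<nu> x) {y. g(x := y) \<in> A} \<le> emeasure (\<nu>' x) {y. g(x := y) \<in> A}"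
    proof (cases "{y. g(x := y) \<in> A} = {}")
      case False
      define l where "l = (LEAST y. g(x := y) \<in> A)"
      have "g(x := l) \<in> A" unfolding l_def using False by (auto intro: LeastI)
      moreover have "(g(x := l)) i \<le> (g(x := y)) i" if "l \<le> y" for i y using that by simp
      ultimately have "g(x := y) \<in> A" if "l \<le> y" for y
        using that insert.prems(2)[of "g(x := l)" "g(x := y)"] by blast
      moreover have "l \<le> y" if "g(x := y) \<in> A" for y
        unfolding l_def using that by (rule Least_le)
      ultimately have "{y. g(x := y) \<in> A} = {l..}" unfolding atLeast_def by blast
      then show ?thesis
        using insert.prems(1)[of x] by (simp add: measure_pmf.emeasure_eq_measure)
    qed simp
  qed
  also have "\<dots> = emeasure (bind_pmf (Pi_pmf I 0 \<nu>') (\<lambda>g. bind_pmf (\<nu>' x) (\<lambda>y. return_pmf (g(x := y))))) A"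
    by (simp add: emeasure_bind_pmf map_pmf_def[symmetric] vimage_def)
  also have "\<dots> = emeasure (Pi_pmf (insert x I) 0 \<nu>') A"
    using insert.hyps by (simp only: bind_commute_pmf[of "Pi_pmf I 0 \<nu>'" "\<nu>' x"] Pi_pmf_insert' not_False_eq_True)
  finally show ?case .
qed

subsection \<open>Renewal times\<close>

lemma sum_power_Suc_le:
  fixes \<rho> :: real
  assumes "0 < \<rho>" "\<rho> < 1"
  shows "(\<Sum>i<m. \<rho> ^ Suc i) \<le> \<rho> / (1 - \<rho>)"
proof -
  have "(\<Sum>i<m. \<rho> ^ Suc i) = \<rho> * ((1 - \<rho> ^ m) / (1 - \<rho>))"
    using assms sum_gp_strict[of \<rho> m] by (simp flip: sum_distrib_left)
  also have "\<dots> \<le> \<rho> * (1 / (1 - \<rho>))"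
    using assms by (intro mult_left_mono divide_right_mono) auto
  finally show ?thesis by simp
qed

text \<open>Call \<open>t\<close> a renewal time after \<open>s\<close> if none of the jumps \<open>X k\<close>, started at \<open>k \<in> {s<..t}\<close>,
  passes \<open>t\<close>. At most one renewal time in \<open>{s<..s + L}\<close> is the last one, and, \<open>f\<close> being increasing,
  the probability of seeing no renewal during the next \<open>L\<close> steps increases with the starting point.
  Hence this probability for \<open>s\<close>, multiplied by the expected number of renewals in
  \<open>{s<..s + L}\<close>, is at most \<open>1\<close>.\<close>

lemma (in prob_space) AE_renewal:
  fixes X :: "nat \<Rightarrow> 'a \<Rightarrow> nat" and f :: "nat \<Rightarrow> real" and \<rho> :: real
  assumes [measurable]: "\<And>i. X i \<in> M \<rightarrow>\<^sub>M count_space UNIV"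
    and \<rho>: "0 < \<rho>" "\<rho> < 1"
    and f: "\<And>j. 1 \<le> j \<Longrightarrow> 0 \<le> f j" "mono_on {1..} f"
    and cdf: "\<And>I a. finite I \<Longrightarrow> 0 \<notin> I \<Longrightarrow>
      prob {\<omega>\<in>space M. \<forall>i\<in>I. X i \<omega> \<le> a i} = (\<Prod>i\<in>I. exp (- f i * \<rho> ^ Suc (a i)))"
    and div: "\<not> summable (\<lambda>j. exp (- (\<rho> / (1 - \<rho>)) * f (Suc j)))"
  shows "AE \<omega> in M. \<exists>n\<ge>1. \<forall>j\<in>{1..n}. X (s + j) \<omega> \<le> n - j"
proof -
  define c where "c = \<rho> / (1 - \<rho>)"
  \<comment> \<open>\<open>\<nu> t\<close> will be the law of the jump at a site with mean
    \<open>t\<close>.\<close>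
  have "\<exists>\<nu>. \<forall>a. measure_pmf.prob \<nu> {..a} = exp (- t * \<rho> ^ Suc a)" if "0 \<le> t" for t
  proof (rule exists_pmf_with_cdf)
    show "mono (\<lambda>a. exp (- t * \<rho> ^ Suc a))"
      using that \<rho> by (intro monoI) (auto intro!: mult_left_mono power_decreasing)
    have "(\<lambda>a. \<rho> ^ Suc a) \<longlonglongrightarrow> 0"
      using \<rho> by (intro LIMSEQ_Suc LIMSEQ_realpow_zero) auto
    then have "(\<lambda>a. exp (- t * \<rho> ^ Suc a)) \<longlonglongrightarrow> exp (- t * 0)"
      by (intro tendsto_intros)
    then show "(\<lambda>a. exp (- t * \<rho> ^ Suc a)) \<longlonglongrightarrow> 1" by simp
  qed simp
  then obtain \<nu> where \<nu>: "\<And>t a. 0 \<le> t \<Longrightarrow> measure_pmf.prob (\<nu> t) {..a} = exp (- t * \<rho> ^ Suc a)"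
    by metis
  \<comment> \<open>\<open>Z s t\<close> says that \<open>t\<close> is a renewal time after
    \<open>s\<close>, and \<open>R s L\<close> that \<open>{s<..s + L}\<close> contains none.
    \<open>V L\<close> expresses the latter through the vector of jumps alone, as an up-closed set
    that does not depend on \<open>s\<close>.\<close>
  define Z where "Z s t = {\<omega>\<in>space M. \<forall>k\<in>{s<..t}. X k \<omega> \<le> t - k}" for s t
  define R where "R s L = {\<omega>\<in>space M. \<forall>n\<in>{1..L}. \<exists>j\<in>{1..n}. n - j < X (s + j) \<omega>}" for s L
  define V where "V L = {v :: nat \<Rightarrow> nat. \<forall>n\<in>{1..L}. \<exists>j\<in>{1..n}. n - j < v j}" for L
  have Z_events [measurable]: "Z s t \<in> events" for s t unfolding Z_def by measurable
  have R_events [measurable]: "R s L \<in> events" for s L unfolding R_def by measurable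
  let ?P = "\<lambda>t L. measure_pmf.prob (Pi_pmf {1..L} 0 (\<lambda>i. \<nu> (f (t + i)))) (V L)"
  \<comment> \<open>Independence: \<open>Z s t\<close> concerns jumps from sites up to
    \<open>t\<close>, and \<open>R t L\<close> only jumps from later sites.\<close>
  have ZR: "prob (Z s t \<inter> R t L) = prob (Z s t) * ?P t L" if "s \<le> t" for s t L
  proof -
    have R: "R t L = {\<omega>\<in>space M. (\<lambda>i. if i \<in> {1..L} then X (t + i) \<omega> else 0) \<in> V L}"
      by (auto simp: R_def V_def)
    have "prob (Z s t \<inter> {\<omega>\<in>space M. \<forall>i\<in>{1..L}. X (t + i) \<omega> \<le> a i}) =
        prob (Z s t) * (\<Prod>i\<in>{1..L}. measure_pmf.prob (\<nu> (f (t + i))) {..a i})" for a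
    proof -
      \<comment> \<open>A single bound function merges both groups of constraints, so that
        \<open>cdf\<close> applies to their conjunction.\<close>
      define b where "b k = (if k \<le> t then t - k else a (k - t))" for k
      have "Z s t \<inter> {\<omega>\<in>space M. \<forall>i\<in>{1..L}. X (t + i) \<omega> \<le> a i} =
          {\<omega>\<in>space M. \<forall>k\<in>{s<..t} \<union> {t<..t+L}. X k \<omega> \<le> b k}"
      proof -
        have "(\<forall>i\<in>{1..L}. X (t + i) \<omega> \<le> a i) \<longleftrightarrow> (\<forall>k\<in>{t<..t+L}. X k \<omega> \<le> b k)" for \<omega>
        proof safe
          fix k assume *: "\<forall>i\<in>{1..L}. X (t + i) \<omega> \<le> a i" "k \<in> {t<..t+L}"
          then have "k - t \<in> {1..L}" by auto
          with *(1) have "X (t + (k - t)) \<omega> \<le> a (k - t)" by blast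
          then show "X k \<omega> \<le> b k" using *(2) by (simp add: b_def)
        next
          fix i assume *: "\<forall>k\<in>{t<..t+L}. X k \<omega> \<le> b k" "i \<in> {1..L}"
          then have "t + i \<in> {t<..t+L}" by auto
          with *(1) have "X (t + i) \<omega> \<le> b (t + i)" by blast
          then show "X (t + i) \<omega> \<le> a i" using *(2) by (simp add: b_def)
        qed
        moreover have "(\<forall>k\<in>{s<..t}. X k \<omega> \<le> t - k) \<longleftrightarrow> (\<forall>k\<in>{s<..t}. X k \<omega> \<le> b k)" for \<omega>
          by (auto simp: b_def)
        ultimately show ?thesis unfolding Z_def by blast
      qed
      then have "prob (Z s t \<inter> {\<omega>\<in>space M. \<forall>i\<in>{1..L}. X (t + i) \<omega> \<le> a i}) =
          (\<Prod>k\<in>{s<..t} \<union> {t<..t+L}. exp (- f k * \<rho> ^ Suc (b k)))"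
        using cdf[of "{s<..t} \<union> {t<..t+L}" b] by simp
      also have "\<dots> = (\<Prod>k\<in>{s<..t}. exp (- f k * \<rho> ^ Suc (b k))) * (\<Prod>k\<in>{t<..t+L}. exp (- f k * \<rho> ^ Suc (b k)))"
        by (intro prod.union_disjoint) auto
      also have "(\<Prod>k\<in>{s<..t}. exp (- f k * \<rho> ^ Suc (b k))) = prob (Z s t)"
        unfolding Z_def by (subst cdf) (auto simp: b_def intro!: prod.cong)
      also have "(\<Prod>k\<in>{t<..t+L}. exp (- f k * \<rho> ^ Suc (b k))) =
          (\<Prod>i\<in>{1..L}. exp (- f (t + i) * \<rho> ^ Suc (a i)))"
        by (rule prod.reindex_bij_witness[of _ "\<lambda>i. t + i" "\<lambda>k. k - t"]) (auto simp: b_def)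
      also have "\<dots> = (\<Prod>i\<in>{1..L}. measure_pmf.prob (\<nu> (f (t + i))) {..a i})"
        by (intro prod.cong refl) (simp add: \<nu> f(1))
      finally show ?thesis .
    qed
    then show ?thesis
      unfolding R by (intro prob_eq_Pi_pmf) auto
  qed
  have R_prob: "prob (R t L) = ?P t L" for t L
  proof -
    \<comment> \<open>The range of sites is empty here, so \<open>ZR\<close> specialises to the law
      of \<open>R\<close> alone.\<close>
    have "Z t t = space M" by (auto simp: Z_def)
    then show ?thesis using ZR[of t t L] R_events[of t L] by (simp add: prob_space)
  qed
  \<comment> \<open>A later starting point raises every mean and hence every tail of the jumps, and
    \<open>V L\<close> is up-closed.\<close>
  have R_mono: "prob (R s L) \<le> prob (R t L)" if "s \<le> t" for s t L
  proof -
    have "emeasure (Pi_pmf {1..L} 0 (\<lambda>i. \<nu> (f (s + i)))) (V L) \<le> emeasure (Pi_pmf {1..L} 0 (\<lambda>i. \<nu> (f (t + i)))) (V L)"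
    proof (rule emeasure_Pi_pmf_upclosed_mono)
      fix i r assume i: "i \<in> {1..L}"
      have fle: "0 \<le> f (s + i)" "f (s + i) \<le> f (t + i)"
        using i that f by (auto intro!: mono_onD[OF f(2)])
      show "measure_pmf.prob (\<nu> (f (s + i))) {r..} \<le> measure_pmf.prob (\<nu> (f (t + i))) {r..}"
      proof (cases r)
        case 0
        then show ?thesis by simp
      next
        case (Suc a)
        then have eq: "{r..} = UNIV - {..a}" by auto
        have compl: "measure_pmf.prob q (UNIV - {..a}) = 1 - measure_pmf.prob q {..a}" for q
          using measure_pmf.prob_compl[of "{..a}" q] by simp
        have "exp (- f (t + i) * \<rho> ^ Suc a) \<le> exp (- f (s + i) * \<rho> ^ Suc a)"
          using fle \<rho> by (auto intro!: mult_right_mono)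
        then show ?thesis unfolding eq compl using fle by (simp add: \<nu>)
      qed
    next
      fix v w assume "v \<in> V L" "\<And>i. v i \<le> w i"
      then show "w \<in> V L" unfolding V_def by (blast intro: less_le_trans)
    qed simp
    then show ?thesis by (simp add: R_prob measure_pmf.emeasure_eq_measure)
  qed
  have R_anti: "prob (R s L') \<le> prob (R s L)" if "L \<le> L'" for s L L'
    using that by (intro finite_measure_mono) (auto simp: R_def)
  \<comment> \<open>Replace each \<open>f k\<close> by the largest value \<open>f (s + m)\<close>;
    the remaining geometric sum is at most \<open>c\<close>.\<close>
  have Z_prob: "exp (- c * f (s + m)) \<le> prob (Z s (s + m))" if "1 \<le> m" for s m
  proof -
    have "(\<Sum>k\<in>{s<..s+m}. f k * \<rho> ^ Suc (s + m - k)) \<le> (\<Sum>k\<in>{s<..s+m}. f (s + m) * \<rho> ^ Suc (s + m - k))"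
      using that \<rho> by (intro sum_mono mult_right_mono mono_onD[OF f(2)]) auto
    also have "\<dots> = f (s + m) * (\<Sum>k\<in>{s<..s+m}. \<rho> ^ Suc (s + m - k))"
      by (simp add: sum_distrib_left)
    also have "(\<Sum>k\<in>{s<..s+m}. \<rho> ^ Suc (s + m - k)) = (\<Sum>i<m. \<rho> ^ Suc i)"
      by (rule sum.reindex_bij_witness[of _ "\<lambda>i. s + m - i" "\<lambda>k. s + m - k"]) auto
    also have "f (s + m) * \<dots> \<le> f (s + m) * c"
      unfolding c_def using that f(1) \<rho> by (intro mult_left_mono sum_power_Suc_le) auto
    finally have "exp (- c * f (s + m)) \<le> exp (\<Sum>k\<in>{s<..s+m}. - f k * \<rho> ^ Suc (s + m - k))"
      by (simp add: sum_negf mult.commute)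
    also have "\<dots> = prob (Z s (s + m))"
      unfolding Z_def by (subst cdf) (auto simp: exp_sum)
    finally show ?thesis .
  qed
  have bound: "prob (R s L) * (\<Sum>m\<in>{1..L}. exp (- c * f (s + m))) \<le> 1" for L
  proof -
    have "prob (R s L) * (\<Sum>m\<in>{1..L}. exp (- c * f (s + m))) =
        (\<Sum>m\<in>{1..L}. exp (- c * f (s + m)) * prob (R s L))"
      by (simp add: sum_distrib_left mult.commute)
    \<comment> \<open>Shortening the window and moving its start to the right both make the absence
      of renewals more likely.\<close>
    also have "\<dots> \<le> (\<Sum>m\<in>{1..L}. prob (Z s (s + m)) * prob (R (s + m) (L - m)))"
    proof (intro sum_mono mult_mono)
      show "prob (R s L) \<le> prob (R (s + m) (L - m))" for m
        using R_anti[of "L - m" L s] R_mono[of s "s + m" "L - m"] by simp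
    qed (use Z_prob in auto)
    also have "\<dots> = (\<Sum>m\<in>{1..L}. prob (Z s (s + m) \<inter> R (s + m) (L - m)))"
      by (simp add: ZR R_prob)
    also have "\<dots> = prob (\<Union>m\<in>{1..L}. Z s (s + m) \<inter> R (s + m) (L - m))"
    proof (rule finite_measure_finite_Union[symmetric])
      \<comment> \<open>A renewal time \<open>s + m'\<close> after \<open>s\<close> is also one
        after \<open>s + m\<close>, where fewer jumps are constrained. This contradicts
        \<open>s + m\<close> being the last one.\<close>
      have "Z s (s + m) \<inter> R (s + m) (L - m) \<inter> (Z s (s + m') \<inter> R (s + m') (L - m')) = {}"
        if "m < m'" "m' \<le> L" for m m'
      proof -
        { fix \<omega> assume *: "\<omega> \<in> R (s + m) (L - m)" "\<omega> \<in> Z s (s + m')"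
          from *(1) that obtain j where j: "j \<in> {1..m' - m}" "m' - m - j < X (s + m + j) \<omega>"
            by (auto simp: R_def dest!: bspec[of _ _ "m' - m"])
          have "s + m + j \<in> {s<..s + m'}" using j(1) that by auto
          with *(2) have "X (s + m + j) \<omega> \<le> s + m' - (s + m + j)" unfolding Z_def by blast
          with j(2) have False by simp }
        then show ?thesis by blast
      qed
      then show "disjoint_family_on (\<lambda>m. Z s (s + m) \<inter> R (s + m) (L - m)) {1..L}"
        unfolding disjoint_family_on_def by (metis Int_commute atLeastAtMost_iff linorder_neqE_nat)
    qed auto
    also have "\<dots> \<le> 1" by simp
    finally show ?thesis .
  qed
  define q where "q = prob {\<omega>\<in>space M. \<forall>n\<ge>1. \<exists>j\<in>{1..n}. n - j < X (s + j) \<omega>}"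
  have q_le: "q \<le> prob (R s L)" for L
    unfolding q_def by (intro finite_measure_mono) (auto simp: R_def)
  \<comment> \<open>\<open>q\<close> is the probability of no renewal ever after \<open>s\<close>.
    If it were positive, \<open>bound\<close> would keep all partial sums of the divergent series
    below \<open>1 / q\<close>.\<close>
  have "q = 0"
  proof (rule ccontr)
    assume "q \<noteq> 0"
    then have q: "0 < q" by (simp add: q_def zero_less_measure_iff)
    have "(\<Sum>m<L. exp (- c * f (s + Suc m))) \<le> 1 / q" for L
    proof -
      have "(\<Sum>m<L. exp (- c * f (s + Suc m))) = (\<Sum>m\<in>{1..L}. exp (- c * f (s + m)))"
        by (rule sum.reindex_bij_witness[of _ "\<lambda>i. i - 1" Suc]) auto
      moreover have "q * (\<Sum>m\<in>{1..L}. exp (- c * f (s + m))) \<le> prob (R s L) * (\<Sum>m\<in>{1..L}. exp (- c * f (s + m)))"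
        by (intro mult_right_mono q_le sum_nonneg) auto
      ultimately show ?thesis using bound[of L] q by (simp add: field_simps)
    qed
    then have "summable (\<lambda>m. exp (- c * f (s + Suc m)))"
      by (intro summableI_nonneg_bounded[where x = "1 / q"]) auto
    then have "summable (\<lambda>j. exp (- c * f (Suc j)))"
      using summable_iff_shift[of "\<lambda>j. exp (- c * f (Suc j))" s] by (simp add: add.commute)
    then show False using div by (simp add: c_def)
  qed
  then have "AE \<omega> in M. \<not> (\<forall>n\<ge>1. \<exists>j\<in>{1..n}. n - j < X (s + j) \<omega>)"
    unfolding q_def by (subst (asm) prob_eq_0) auto
  then show ?thesis by eventually_elim (auto simp: not_less)
qed

subsection \<open>The frog process\<close>

lemma frog_pos_walk_right: "frog_pos \<omega> a n = int (fst a) + walk False (snd \<omega> a) n"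
  unfolding frog_pos_def walk_def by (auto intro!: sum.cong)

lemma frog_pos_walk_left: "frog_pos \<omega> a n = int (fst a) - walk True (snd \<omega> a) n"
  unfolding frog_pos_def walk_def by (auto intro!: sum.cong simp flip: sum_negf)

lemma frog_reaches_iff:
  "fst a \<le> j \<Longrightarrow> (\<exists>n. frog_pos \<omega> a n = int j) \<longleftrightarrow> hits False (j - fst a) (snd \<omega> a)"
  unfolding hits_def frog_pos_walk_right by (auto simp: of_nat_diff algebra_simps)

lemma frog_reaches_origin_iff: "(\<exists>n. frog_pos \<omega> a n = 0) \<longleftrightarrow> hits True (fst a) (snd \<omega> a)"
  unfolding hits_def frog_pos_walk_left by (metis eq_iff_diff_eq_0)

text \<open>This looks at what the frogs of site \<open>j\<close> would do once awake, through their
  own coins only. Whether they are ever woken is left out, which keeps different sites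
  independent.\<close>

definition quiet :: "frog_omega \<Rightarrow> nat \<Rightarrow> nat \<Rightarrow> bool" where
  "quiet \<omega> j m \<longleftrightarrow> (\<forall>k<fst \<omega> j. \<not> hits False m (snd \<omega> (j, k)))"

lemma quiet_mono: "quiet \<omega> j m \<Longrightarrow> m \<le> m' \<Longrightarrow> quiet \<omega> j m'"
  unfolding quiet_def using hits_antimono by blast

lemma quiet_0 [simp]: "quiet \<omega> j 0 \<longleftrightarrow> fst \<omega> j = 0"
  by (auto simp: quiet_def)

lemma quiet_measurable [measurable]: "Measurable.pred (frog_space p f) (\<lambda>\<omega>. quiet \<omega> j m)"
proof -
  have "Measurable.pred (frog_space p f) (\<lambda>\<omega>. \<forall>k. k < fst \<omega> j \<longrightarrow> \<not> hits False m (snd \<omega> (j, k)))"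
    by measurable
  then show ?thesis by (simp add: quiet_def)
qed

text \<open>Invariant along activation: an active frog starts at most at \<open>n\<close> and never
  visits \<open>n + 1\<close>. A frog waking a site beyond \<open>n\<close> would have to pass
  through \<open>n + 1\<close>, so only the finitely many frogs up to \<open>n\<close> can be
  active.\<close>

lemma finite_active_frogs:
  assumes "\<not> hits False (Suc n) (snd \<omega> (0, 0))" "\<forall>j\<in>{1..n}. quiet \<omega> j (Suc (n - j))"
  shows "finite (active_frogs \<omega>)"
proof (rule finite_subset)
  have *: "fst a \<le> n \<and> \<not> hits False (Suc n - fst a) (snd \<omega> a) \<and> (a = (0, 0) \<or> snd a < fst \<omega> (fst a))"
    if "a \<in> active_frogs \<omega>" for a
    using that
  proof induction
    case init
    then show ?case using assms(1) by simp
  next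
    case (wake a j k m)
    have "j \<le> n"
    proof (rule ccontr)
      assume "\<not> j \<le> n"
      then have "hits False (j - fst a) (snd \<omega> a)"
        using wake frog_reaches_iff[of a j \<omega>] by force
      then have "hits False (Suc n - fst a) (snd \<omega> a)"
        using \<open>\<not> j \<le> n\<close> by (auto intro: hits_antimono)
      then show False using wake by simp
    qed
    moreover from this have "quiet \<omega> j (Suc (n - j))" using assms(2) wake by simp
    ultimately show ?case using wake by (simp add: quiet_def Suc_diff_le)
  qed
  show "active_frogs \<omega> \<subseteq> insert (0, 0) (SIGMA j:{..n}. {..<fst \<omega> j})"
  proof
    fix a assume "a \<in> active_frogs \<omega>"
    then have "fst a \<le> n" "a = (0, 0) \<or> snd a < fst \<omega> (fst a)" using * by blast+
    then show "a \<in> insert (0, 0) (SIGMA j:{..n}. {..<fst \<omega> j})" by (cases a) auto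
  qed
qed auto

text \<open>Strong induction shows that active frogs visit every positive site. The initial frog
  covers the sites up to \<open>N\<close>; for \<open>j > N\<close>, some frog from
  \<open>{1..j - 1}\<close> crosses the barrier \<open>j - 1\<close>, thus reaches \<open>j\<close>,
  and it is awake because its home was visited.\<close>

lemma all_frogs_active:
  assumes "hits False N (snd \<omega> (0, 0))" "\<And>n. N \<le> n \<Longrightarrow> \<not> (\<forall>j\<in>{1..n}. quiet \<omega> j (Suc (n - j)))"
    and "1 \<le> j" "k < fst \<omega> j"
  shows "(j, k) \<in> active_frogs \<omega>"
proof -
  have "\<exists>a\<in>active_frogs \<omega>. \<exists>m. frog_pos \<omega> a m = int j" if "1 \<le> j" for j
    using that
  proof (induction j rule: less_induct)
    case (less j)
    show ?case
    proof (cases "j \<le> N")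
      case True
      then have "hits False j (snd \<omega> (0, 0))" using assms(1) by (auto intro: hits_antimono)
      then show ?thesis
        using frog_reaches_iff[of "(0, 0)" j \<omega>] active_frogs.init[of \<omega>] by auto
    next
      case False
      then have "N \<le> j - 1" by simp
      then obtain i k where i: "i \<in> {1..j - 1}" "k < fst \<omega> i" "hits False (Suc (j - 1 - i)) (snd \<omega> (i, k))"
        using assms(2)[of "j - 1"] unfolding quiet_def by blast
      then have "(i, k) \<in> active_frogs \<omega>"
        using less.IH[of i] less.prems by (force intro: active_frogs.wake)
      moreover have "Suc (j - 1 - i) = j - i" using i(1) by auto
      then have "\<exists>m. frog_pos \<omega> (i, k) m = int j"
        using i frog_reaches_iff[of "(i, k)" j \<omega>] by auto
      ultimately show ?thesis by blast
    qed
  qed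
  then show ?thesis using assms(3,4) by (blast intro: active_frogs.wake)
qed

section \<open>Probabilities and almost sure events for the frogs\<close>

lemma prob_hits_right:
  assumes "1/2 < p" "p < 1"
  shows "measure (coin_seq p) {x. hits False m x} = ((1 - p) / p) ^ m"
  using prob_hits_unfavourable[of p False m] assms by (simp add: coin_prob_def)

lemma AE_frog_hits_left:
  assumes "1/2 < p" "p < 1"
  shows "AE \<omega> in frog_space p f. hits True m (snd \<omega> a)"
proof -
  interpret S: prob_space "coin_seq p" by (rule prob_space_coin_seq)
  interpret P: pair_prob_space "PiM UNIV (\<lambda>j::nat. measure_pmf (pois (if j = 0 then 0 else f j)))"
      "PiM UNIV (\<lambda>_::nat \<times> nat. coin_seq p)"
    unfolding pair_prob_space_def pair_sigma_finite_def
    by (intro conjI prob_space_imp_sigma_finite prob_space_PiM prob_space_coin_seq prob_space_measure_pmf)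
  have "AE x in coin_seq p. x \<in> {x. hits True m x}"
    using prob_hits_favourable[of p True m] assms by (intro S.AE_prob_1) (simp add: coin_prob_def)
  then have "AE x in coin_seq p. hits True m x" by simp
  then have "AE w in PiM UNIV (\<lambda>_::nat \<times> nat. coin_seq p). hits True m (w a)"
    by (intro AE_PiM_component[where M = "\<lambda>_. coin_seq p"] prob_space_coin_seq) auto
  moreover have "{\<omega> \<in> space (frog_space p f). hits True m (snd \<omega> a)} \<in> sets (frog_space p f)"
    by measurable
  ultimately show ?thesis
    unfolding frog_space_def by (intro P.AE_pair_measure) auto
qed

text \<open>Taking \<open>N = 0\<close> removes the condition on the initial frog, and
  \<open>I = {}\<close> the one on the sleeping frogs; both specialisations occur below.\<close>

lemma prob_quiet:
  fixes I :: "nat set"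
  assumes p: "1/2 < p" "p < 1" and I: "finite I" "0 \<notin> I" and f: "\<And>j. 1 \<le> j \<Longrightarrow> 0 \<le> f j"
  shows "measure (frog_space p f) {\<omega>. hits False N (snd \<omega> (0, 0)) \<and> (\<forall>j\<in>I. quiet \<omega> j (a j))} =
    ((1 - p) / p) ^ N * (\<Prod>j\<in>I. exp (- f j * ((1 - p) / p) ^ a j))"
proof -
  have "0 \<le> f j" if "j \<in> I" for j using that I f[of j] by (cases j) auto
  then show ?thesis
    using prob_frog_space_cylinder[where p = p and C = "hits False N" and H = "\<lambda>j. hits False (a j)" and I = I and f = f] I p
    by (simp add: quiet_def prob_hits_right)
qed

text \<open>The event that every \<open>P a\<close> holds lies inside each single one, so its
  probability is below a sequence tending to \<open>0\<close>.\<close>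

lemma (in prob_space) AE_exists_not:
  fixes P :: "nat \<Rightarrow> 'a \<Rightarrow> bool"
  assumes [measurable]: "\<And>a. Measurable.pred M (P a)"
    and lim: "(\<lambda>a. prob {\<omega>\<in>space M. P a \<omega>}) \<longlonglongrightarrow> 0"
  shows "AE \<omega> in M. \<exists>a. \<not> P a \<omega>"
proof -
  have "prob {\<omega>\<in>space M. \<forall>a. P a \<omega>} \<le> 0"
    using lim by (rule LIMSEQ_le_const) (auto intro!: finite_measure_mono exI[of _ 0])
  then have "prob {\<omega>\<in>space M. \<forall>a. P a \<omega>} = 0"
    using measure_nonneg[of M "{\<omega>\<in>space M. \<forall>a. P a \<omega>}"] by linarith
  then have "AE \<omega> in M. \<not> (\<forall>a. P a \<omega>)"
    by (subst (asm) prob_eq_0) auto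
  then show ?thesis by simp
qed

section \<open>Divergent series: the process is confined\<close>

lemma transient_if_not_summable:
  fixes p :: real and f :: "nat \<Rightarrow> real"
  assumes p: "1/2 < p" "p < 1"
    and f: "\<And>j. 1 \<le> j \<Longrightarrow> 0 \<le> f j" "mono_on {1..} f"
    and div: "\<not> summable (\<lambda>j. exp (- ((1 - p) / (2 * p - 1)) * f (Suc j)))"
  shows "frog_transient p f"
proof -
  interpret F: prob_space "frog_space p f" by (rule prob_space_frog_space)
  define \<rho> where "\<rho> = (1 - p) / p"
  have \<rho>: "0 < \<rho>" "\<rho> < 1" using p by (auto simp: \<rho>_def)
  have c: "\<rho> / (1 - \<rho>) = (1 - p) / (2 * p - 1)" using p by (simp add: \<rho>_def field_simps)
  have pow: "(\<lambda>m. \<rho> ^ m) \<longlonglongrightarrow> 0" using \<rho> by (intro LIMSEQ_realpow_zero) auto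
  have quiet_prob: "F.prob {\<omega>. \<forall>j\<in>I. quiet \<omega> j (a j)} = (\<Prod>j\<in>I. exp (- f j * \<rho> ^ a j))"
    if "finite I" "0 \<notin> I" for I a
    using prob_quiet[where f = f and N = 0 and a = a, OF p that] f(1) by (simp add: \<rho>_def)
  \<comment> \<open>The rightmost displacement of the frogs at \<open>j\<close>; junk on the null event that it is infinite.\<close>
  define X where "X j \<omega> = (LEAST a. quiet \<omega> j (Suc a))" for j \<omega>
  have [measurable]: "X j \<in> frog_space p f \<rightarrow>\<^sub>M count_space UNIV" for j
    unfolding X_def by measurable
  have "AE \<omega> in frog_space p f. \<exists>a. \<not> \<not> quiet \<omega> j (Suc a)" if "1 \<le> j" for j
  proof (rule F.AE_exists_not)
    have "F.prob {\<omega>. \<not> quiet \<omega> j (Suc a)} = 1 - exp (- f j * \<rho> ^ Suc a)" for a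
    proof -
      have "{\<omega>\<in>space (frog_space p f). quiet \<omega> j (Suc a)} \<in> F.events" by measurable
      then have "F.prob (UNIV - {\<omega>. quiet \<omega> j (Suc a)}) = 1 - F.prob {\<omega>. quiet \<omega> j (Suc a)}"
        using F.prob_compl[of "{\<omega>. quiet \<omega> j (Suc a)}"] by simp
      moreover have "UNIV - {\<omega>. quiet \<omega> j (Suc a)} = {\<omega>. \<not> quiet \<omega> j (Suc a)}" by auto
      ultimately show ?thesis using quiet_prob[of "{j}" "\<lambda>_. Suc a"] that by simp
    qed
    moreover have "(\<lambda>a. 1 - exp (- f j * \<rho> ^ Suc a)) \<longlonglongrightarrow> 1 - exp (- f j * 0)"
      by (intro tendsto_intros LIMSEQ_Suc[OF pow])
    ultimately show "(\<lambda>a. F.prob {\<omega>\<in>space (frog_space p f). \<not> quiet \<omega> j (Suc a)}) \<longlonglongrightarrow> 0" by simp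
  qed measurable
  then have "AE \<omega> in frog_space p f. \<forall>j. 1 \<le> j \<longrightarrow> (\<exists>a. quiet \<omega> j (Suc a))"
    by (simp add: AE_all_countable)
  \<comment> \<open>Almost surely some threshold is quiet, so the minimum in \<open>X\<close> is
    attained and monotonicity of \<open>quiet\<close> gives the equivalence. It transfers the
    explicit probabilities of \<open>quiet\<close> to the distribution function of
    \<open>X\<close>.\<close>
  then have X_iff: "AE \<omega> in frog_space p f. \<forall>j a. 1 \<le> j \<longrightarrow> (X j \<omega> \<le> a \<longleftrightarrow> quiet \<omega> j (Suc a))"
  proof eventually_elim
    case (elim \<omega>)
    have "X j \<omega> \<le> a \<longleftrightarrow> quiet \<omega> j (Suc a)" if "1 \<le> j" for j a
    proof
      assume "X j \<omega> \<le> a"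
      moreover have "quiet \<omega> j (Suc (X j \<omega>))"
        unfolding X_def by (rule LeastI_ex) (use elim that in blast)
      ultimately show "quiet \<omega> j (Suc a)" by (auto intro: quiet_mono)
    qed (auto simp: X_def intro: Least_le)
    then show ?case by blast
  qed
  have renewal: "AE \<omega> in frog_space p f. \<exists>n\<ge>1. \<forall>j\<in>{1..n}. X (s + j) \<omega> \<le> n - j" for s
  proof (rule F.AE_renewal[where f = f and \<rho> = \<rho>])
    fix I :: "nat set" and a assume I: "finite I" "0 \<notin> I"
    have "F.prob {\<omega>\<in>space (frog_space p f). \<forall>i\<in>I. X i \<omega> \<le> a i} =
        F.prob {\<omega>\<in>space (frog_space p f). \<forall>i\<in>I. quiet \<omega> i (Suc (a i))}"
    proof (rule F.finite_measure_eq_AE)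
      have pos: "1 \<le> i" if "i \<in> I" for i using I(2) that by (cases i) auto
      show "AE \<omega> in frog_space p f. (\<omega> \<in> {\<omega>\<in>space (frog_space p f). \<forall>i\<in>I. X i \<omega> \<le> a i}) =
          (\<omega> \<in> {\<omega>\<in>space (frog_space p f). \<forall>i\<in>I. quiet \<omega> i (Suc (a i))})"
        using X_iff
      proof eventually_elim
        case (elim \<omega>)
        then have "(\<forall>i\<in>I. X i \<omega> \<le> a i) \<longleftrightarrow> (\<forall>i\<in>I. quiet \<omega> i (Suc (a i)))" using pos by blast
        then show ?case by simp
      qed
    qed (use I in measurable)
    then show "F.prob {\<omega>\<in>space (frog_space p f). \<forall>i\<in>I. X i \<omega> \<le> a i} = (\<Prod>i\<in>I. exp (- f i * \<rho> ^ Suc (a i)))"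
      using quiet_prob[OF I, of "\<lambda>i. Suc (a i)"] by simp
  qed (use div \<rho> f in \<open>auto simp: c\<close>)
  have initial: "AE \<omega> in frog_space p f. \<exists>h. \<not> hits False h (snd \<omega> (0, 0))"
  proof (rule F.AE_exists_not)
    show "(\<lambda>h. F.prob {\<omega>\<in>space (frog_space p f). hits False h (snd \<omega> (0, 0))}) \<longlonglongrightarrow> 0"
      using prob_quiet[where f = f and I = "{}", OF p] f(1) pow by (simp add: \<rho>_def)
  qed measurable
  have "AE \<omega> in frog_space p f. \<forall>s. \<exists>n\<ge>1. \<forall>j\<in>{1..n}. X (s + j) \<omega> \<le> n - j"
    using renewal by (simp add: AE_all_countable)
  with X_iff initial have "AE \<omega> in frog_space p f. finite (active_frogs \<omega>)"
  proof eventually_elim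
    case (elim \<omega>)
    \<comment> \<open>Renewals concatenate: if jumps from sites up to \<open>t\<close> stay within
      \<open>t\<close> and those from the next \<open>n\<close> sites stay within
      \<open>t + n\<close>, then \<open>t + n\<close> is a renewal time counted from
      \<open>0\<close>. Repetition passes any \<open>h\<close>.\<close>
    have "\<exists>t\<ge>h. \<forall>k\<in>{1..t}. X k \<omega> \<le> t - k" for h
    proof (induction h)
      case 0
      show ?case by (intro exI[of _ 0]) auto
    next
      case (Suc h)
      then obtain t where t: "h \<le> t" "\<forall>k\<in>{1..t}. X k \<omega> \<le> t - k" by blast
      obtain n where n: "1 \<le> n" "\<forall>j\<in>{1..n}. X (t + j) \<omega> \<le> n - j" using elim(3) by blast
      have "X k \<omega> \<le> t + n - k" if "k \<in> {1..t + n}" for k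
      proof (cases "k \<le> t")
        case True
        then have "X k \<omega> \<le> t - k" using t that by auto
        then show ?thesis by linarith
      next
        case False
        then have "k - t \<in> {1..n}" using that by auto
        then have "X (t + (k - t)) \<omega> \<le> n - (k - t)" using n by blast
        then show ?thesis using False by simp
      qed
      then show ?case using t n by (intro exI[of _ "t + n"]) auto
    qed
    moreover obtain h where h: "\<not> hits False h (snd \<omega> (0, 0))" using elim(2) by blast
    ultimately obtain t where t: "h \<le> t" "\<forall>k\<in>{1..t}. X k \<omega> \<le> t - k" by blast
    show ?case
    proof (rule finite_active_frogs[of t])
      show "\<not> hits False (Suc t) (snd \<omega> (0, 0))" using h t(1) hits_antimono[of False "Suc t" _ h] by auto
      show "\<forall>j\<in>{1..t}. quiet \<omega> j (Suc (t - j))" using t(2) elim(1) by auto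
    qed
  qed
  then show ?thesis
    unfolding frog_transient_def
    by eventually_elim (auto simp: frogs_hitting_origin_def intro: finite_subset)
qed

section \<open>Convergent series: infinitely many frogs reach the origin with positive
  probability\<close>

lemma summable_contraction:
  fixes u v :: "nat \<Rightarrow> real"
  assumes u: "\<And>n. 0 \<le> u n" and v: "\<And>n. 0 \<le> v n" "summable v" and \<rho>: "\<rho> < 1"
    and rec: "\<And>n. u (Suc n) \<le> \<rho> * u n + v n"
  shows "summable u"
proof (rule summableI_nonneg_bounded)
  fix N
  \<comment> \<open>Summing the recursion bounds a partial sum \<open>U\<close> by
    \<open>u 0 + \<rho> * U + suminf v\<close>; this is solved for \<open>U\<close>.\<close>
  have "(\<Sum>n<N. u n) \<le> (\<Sum>n<Suc N. u n)" using u by simp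
  also have "\<dots> = u 0 + (\<Sum>n<N. u (Suc n))" by (rule sum.lessThan_Suc_shift)
  also have "(\<Sum>n<N. u (Suc n)) \<le> (\<Sum>n<N. \<rho> * u n + v n)" by (intro sum_mono rec)
  also have "\<dots> = \<rho> * (\<Sum>n<N. u n) + (\<Sum>n<N. v n)" by (simp add: sum.distrib sum_distrib_left)
  also have "(\<Sum>n<N. v n) \<le> suminf v" using v by (intro sum_le_suminf) auto
  finally show "(\<Sum>n<N. u n) \<le> (u 0 + suminf v) / (1 - \<rho>)" using \<rho> by (simp add: field_simps)
qed (rule u)

lemma not_transient_if_summable:
  fixes p :: real and f :: "nat \<Rightarrow> real"
  assumes p: "1/2 < p" "p < 1"
    and f: "\<And>j. 1 \<le> j \<Longrightarrow> 0 \<le> f j"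
    and conv: "summable (\<lambda>j. exp (- ((1 - p) / (2 * p - 1)) * f (Suc j)))"
  shows "\<not> frog_transient p f"
proof
  assume trans: "frog_transient p f"
  interpret F: prob_space "frog_space p f" by (rule prob_space_frog_space)
  define \<rho> where "\<rho> = (1 - p) / p"
  have \<rho>: "0 < \<rho>" "\<rho> < 1" using p by (auto simp: \<rho>_def)
  define c where "c = (1 - p) / (2 * p - 1)"
  have c: "0 < c" "\<rho> = (1 - \<rho>) * c" using p by (auto simp: \<rho>_def c_def field_simps)
  \<comment> \<open>The probability that barrier \<open>n\<close> stays uncrossed: from
    \<open>j\<close>, the distance to \<open>n + 1\<close> is \<open>Suc (n - j)\<close>.\<close>
  define u where "u n = (\<Prod>j\<in>{1..n}. exp (- f j * \<rho> ^ Suc (n - j)))" for n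
  have "summable u"
  proof (rule summable_contraction)
    show "summable (\<lambda>n. (1 - \<rho>) * exp (- c * f (Suc n)))"
      using conv by (intro summable_mult) (simp add: c_def)
    fix n
    define S where "S = (\<Sum>j\<in>{1..n}. f j * \<rho> ^ Suc (n - j))"
    have "u n = exp (- S)" by (simp add: u_def S_def exp_sum flip: sum_negf)
    moreover have "u (Suc n) = exp (- (\<rho> * S + (1 - \<rho>) * (c * f (Suc n))))"
    proof -
      have "(\<Sum>j\<in>{1..Suc n}. f j * \<rho> ^ Suc (Suc n - j)) = (\<Sum>j\<in>{1..n}. f j * \<rho> ^ Suc (Suc n - j)) + f (Suc n) * \<rho>"
        by simp
      also have "(\<Sum>j\<in>{1..n}. f j * \<rho> ^ Suc (Suc n - j)) = \<rho> * S"
        unfolding S_def sum_distrib_left by (intro sum.cong) (auto simp: Suc_diff_le)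
      also have "f (Suc n) * \<rho> = (1 - \<rho>) * (c * f (Suc n))" using c(2) by (metis mult.assoc mult.commute)
      finally have "(\<Sum>j\<in>{1..Suc n}. f j * \<rho> ^ Suc (Suc n - j)) = \<rho> * S + (1 - \<rho>) * (c * f (Suc n))" .
      moreover have "u (Suc n) = exp (- (\<Sum>j\<in>{1..Suc n}. f j * \<rho> ^ Suc (Suc n - j)))"
        unfolding u_def sum_negf[symmetric] by (subst exp_sum) auto
      ultimately show ?thesis by (simp only:)
    qed
    \<comment> \<open>The exponent of \<open>u (Suc n)\<close> is a convex combination with weights
      \<open>1 - \<rho>\<close> and \<open>\<rho>\<close>, so convexity yields the contraction
      recursion.\<close>
    moreover have "exp ((1 - \<rho>) *\<^sub>R (- (c * f (Suc n))) + \<rho> *\<^sub>R (- S)) \<le> (1 - \<rho>) * exp (- (c * f (Suc n))) + \<rho> * exp (- S)"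
      using \<rho> by (intro convex_onD[OF exp_convex]) auto
    ultimately show "u (Suc n) \<le> \<rho> * u n + (1 - \<rho>) * exp (- c * f (Suc n))"
      by (simp add: algebra_simps)
  qed (use \<rho> in \<open>auto simp: u_def intro!: prod_nonneg\<close>)
  \<comment> \<open>A tail sum below \<open>1\<close> is what the union bound needs: the bad events
    within \<open>R\<close> then have total probability less than \<open>\<rho> ^ N\<close>, the
    probability of \<open>R\<close>.\<close>
  then obtain N where N: "norm (\<Sum>n. u (n + N)) < 1"
    using suminf_exist_split[of 1 u] by auto
  define R where "R = {\<omega> :: frog_omega. hits False N (snd \<omega> (0, 0))}"
  define Q where "Q n = {\<omega> \<in> R. \<forall>j\<in>{1..n}. quiet \<omega> j (Suc (n - j))}" for n
  have "{\<omega> \<in> space (frog_space p f). hits False N (snd \<omega> (0, 0))} \<in> F.events" by measurable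
  then have R_ev: "R \<in> F.events" by (simp add: R_def)
  have "{\<omega> \<in> space (frog_space p f). hits False N (snd \<omega> (0, 0)) \<and> (\<forall>j\<in>{1..n}. quiet \<omega> j (Suc (n - j)))} \<in> F.events" for n
    by measurable
  then have Q_ev: "Q n \<in> F.events" for n by (simp add: Q_def R_def)
  have R_prob: "F.prob R = \<rho> ^ N"
    using prob_quiet[where f = f and I = "{}" and N = N, OF p] f by (simp add: R_def \<rho>_def)
  have Q_prob: "F.prob (Q n) = \<rho> ^ N * u n" for n
    using prob_quiet[where f = f and I = "{1..n}" and N = N and a = "\<lambda>j. Suc (n - j)", OF p] f by (simp add: Q_def R_def \<rho>_def u_def)
  have sN: "summable (\<lambda>n. u (n + N))" using \<open>summable u\<close> by (simp add: summable_iff_shift)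
  have "F.prob (\<Union>n. Q (n + N)) \<le> (\<Sum>n. F.prob (Q (n + N)))"
    using Q_ev sN by (intro F.finite_measure_subadditive_countably) (auto simp: Q_prob intro: summable_mult)
  also have "\<dots> = \<rho> ^ N * (\<Sum>n. u (n + N))" using sN by (simp add: Q_prob suminf_mult)
  also have "\<dots> < \<rho> ^ N" using N \<rho> by simp
  finally have "0 < F.prob R - F.prob (\<Union>n. Q (n + N))" using R_prob by simp
  also have "\<dots> = F.prob (R - (\<Union>n. Q (n + N)))"
    using R_ev Q_ev by (intro F.finite_measure_Diff[symmetric]) (auto simp: Q_def)
  finally have pos: "0 < F.prob (R - (\<Union>n. Q (n + N)))" .
  \<comment> \<open>Waking every frog yields infinitely many visitors only if infinitely many sites
    are occupied. Emptiness of a site has probability \<open>exp (- f j)\<close>, which tends to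
    \<open>0\<close> as the power \<open>1 / c\<close> of the summands.\<close>
  have populated: "AE \<omega> in frog_space p f. \<exists>n. \<not> fst \<omega> (n + Suc J) = 0" for J
  proof (rule F.AE_exists_not)
    have "(\<lambda>n. exp (- c * f (Suc n))) \<longlonglongrightarrow> 0"
      using conv by (intro summable_LIMSEQ_zero) (simp add: c_def)
    then have "(\<lambda>n. exp (- c * f (Suc n)) powr (1 / c)) \<longlonglongrightarrow> 0"
      using c by (intro tendsto_zero_powrI[where b = "1 / c"]) auto
    then have "(\<lambda>n. exp (- f (Suc n))) \<longlonglongrightarrow> 0" using c by (simp add: powr_def)
    then have "(\<lambda>n. exp (- f (n + Suc J))) \<longlonglongrightarrow> 0"
      using LIMSEQ_ignore_initial_segment[of "\<lambda>n. exp (- f (Suc n))" 0 J] by simp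
    moreover have "F.prob {\<omega>. fst \<omega> (n + Suc J) = 0} = exp (- f (n + Suc J))" for n
      using prob_quiet[where f = f and I = "{n + Suc J}" and N = 0 and a = "\<lambda>_. 0", OF p] f by simp
    ultimately show "(\<lambda>n. F.prob {\<omega>\<in>space (frog_space p f). fst \<omega> (n + Suc J) = 0}) \<longlonglongrightarrow> 0"
      by simp
  qed measurable
  have "AE \<omega> in frog_space p f. \<forall>J. \<exists>n. \<not> fst \<omega> (n + Suc J) = 0"
    using populated by (simp add: AE_all_countable)
  moreover have "AE \<omega> in frog_space p f. \<forall>a. hits True (fst a) (snd \<omega> a)"
    using AE_frog_hits_left[OF p] by (simp add: AE_all_countable)
  moreover have "AE \<omega> in frog_space p f. finite (frogs_hitting_origin \<omega>)"
    using trans by (simp add: frog_transient_def)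
  ultimately have "AE \<omega> in frog_space p f. \<omega> \<notin> R - (\<Union>n. Q (n + N))"
  proof eventually_elim
    case (elim \<omega>)
    show ?case
    proof
      assume \<omega>: "\<omega> \<in> R - (\<Union>n. Q (n + N))"
      have active: "(j, k) \<in> active_frogs \<omega>" if "1 \<le> j" "k < fst \<omega> j" for j k
      proof (rule all_frogs_active[OF _ _ that])
        show "hits False N (snd \<omega> (0, 0))" using \<omega> by (simp add: R_def)
        show "\<not> (\<forall>j\<in>{1..n}. quiet \<omega> j (Suc (n - j)))" if "N \<le> n" for n
        proof -
          have "\<omega> \<notin> Q (n - N + N)" using \<omega> by blast
          then show ?thesis using that \<omega> by (simp add: Q_def)
        qed
      qed
      \<comment> \<open>Each occupied site contributes its frog with index \<open>0\<close>;
        projecting to starting sites reduces the contradiction to infinitely many occupied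
        sites.\<close>
      have sub: "{j. 1 \<le> j \<and> 0 < fst \<omega> j} \<subseteq> fst ` frogs_hitting_origin \<omega>"
      proof
        fix j assume "j \<in> {j. 1 \<le> j \<and> 0 < fst \<omega> j}"
        then have "(j, 0) \<in> frogs_hitting_origin \<omega>"
          using active[of j 0] elim(2) by (simp add: frogs_hitting_origin_def frog_reaches_origin_iff)
        then show "j \<in> fst ` frogs_hitting_origin \<omega>" by force
      qed
      have "infinite {j. 1 \<le> j \<and> 0 < fst \<omega> j}"
        unfolding infinite_nat_iff_unbounded_le
      proof
        fix J
        obtain n where "fst \<omega> (n + Suc J) \<noteq> 0" using elim(1) by blast
        then show "\<exists>n\<ge>J. n \<in> {j. 1 \<le> j \<and> 0 < fst \<omega> j}" by (intro exI[of _ "n + Suc J"]) auto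
      qed
      then show False using sub elim(3) finite_subset by blast
    qed
  qed
  then have "F.prob (R - (\<Union>n. Q (n + N))) = 0"
    using R_ev Q_ev by (subst F.prob_eq_0) auto
  then show False using pos by simp
qed

theorem theorem2:
  fixes p :: real and f :: "nat \<Rightarrow> real"
  assumes "1/2 < p" and "p < 1"
    and "\<And>j. 1 \<le> j \<Longrightarrow> 0 \<le> f j"
    and "mono_on {1..} f"
  shows "frog_transient p f \<longleftrightarrow>
         \<not> summable (\<lambda>j. exp (- ((1 - p) / (2 * p - 1)) * f (Suc j)))"
  using transient_if_not_summable[of p f] not_transient_if_summable[of p f] assms by blast

end
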